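(* For every natural number $m$ and every model $\mathfrak{A}$ of Presburger Arithmetic $\mathrm{PrA}$ that is $m$-dimensionally interpreted in $(\mathbb{N},+)$, the model $\mathfrak{A}$ is isomorphic to $(\mathbb{N},+)$.
   Context: $\mathrm{PrA}$ is the first-order theory of $(\mathbb{N},+)$. An $m$-dimensional translation $\iota$ from signature $\{=,+\}$ to signature $\{=,+\}$ consists of formulas $\mathit{Dom}_\iota(\bar y)$, $\mathit{Pred}_{\iota,=}(\bar y_1,\bar y_2)$, $\mathit{Fun}_{\iota,+}(\bar y_0,\bar y_1,\bar y_2)$ over $\{=,+\}$, each $\bar y_i$ an $m$-tuple of variables. It is an interpretation of a structure $\mathfrak{A}=(A,+^{\mathfrak{A}})$ in $(\mathbb{N},+)$ if $\mathit{Dom}_\iota$ defines a nonempty $D\subseteq\mathbb{N}^m$, $\mathit{Pred}_{\iota,=}$ defines an equivalence relation $\sim$ on $D$, and there is a bijection $h:D/{\sim}\to A$ such that for all $\bar b_0,\bar b_1,\bar b_2\in D$: $h([\bar b_0])=h([\bar b_1])+^{\mathfrak{A}}h([\bar b_2])$ iff $(\mathbb{N},+)\models\mathit{Fun}_{\iota,+}(\bar b_0,\bar b_1,\bar b_2)$. $\mathfrak{A}$ is $m$-dimensionally interpreted in $(\mathbb{N},+)$ if such an $\iota$ exists. *)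

theory Defs
  imports Main
begin

section \<open>First-order logic over the signature of equality and addition\<close>

datatype tm = Var nat | Plus tm tm

datatype fm = Eq tm tm | Neg fm | Conj fm fm | Ex nat fm

primrec tm_vars :: "tm \<Rightarrow> nat set" where
  "tm_vars (Var x) = {x}"
| "tm_vars (Plus s t) = tm_vars s \<union> tm_vars t"

primrec free_vars :: "fm \<Rightarrow> nat set" where
  "free_vars (Eq s t) = tm_vars s \<union> tm_vars t"
| "free_vars (Neg p) = free_vars p"
| "free_vars (Conj p q) = free_vars p \<union> free_vars q"
| "free_vars (Ex x p) = free_vars p - {x}"

record 'a add_structure =
  univ :: "'a set"
  add :: "'a \<Rightarrow> 'a \<Rightarrow> 'a"

definition is_structure :: "'a add_structure \<Rightarrow> bool" where
  "is_structure S \<longleftrightarrow>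
     univ S \<noteq> {} \<and> (\<forall>x\<in>univ S. \<forall>y\<in>univ S. add S x y \<in> univ S)"

primrec tm_val :: "'a add_structure \<Rightarrow> (nat \<Rightarrow> 'a) \<Rightarrow> tm \<Rightarrow> 'a" where
  "tm_val S e (Var x) = e x"
| "tm_val S e (Plus s t) = add S (tm_val S e s) (tm_val S e t)"

primrec sat :: "'a add_structure \<Rightarrow> (nat \<Rightarrow> 'a) \<Rightarrow> fm \<Rightarrow> bool" where
  "sat S e (Eq s t) \<longleftrightarrow> tm_val S e s = tm_val S e t"
| "sat S e (Neg p) \<longleftrightarrow> \<not> sat S e p"
| "sat S e (Conj p q) \<longleftrightarrow> sat S e p \<and> sat S e q"
| "sat S e (Ex x p) \<longleftrightarrow> (\<exists>a\<in>univ S. sat S (e(x := a)) p)"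

definition sentence :: "fm \<Rightarrow> bool" where
  "sentence p \<longleftrightarrow> free_vars p = {}"

definition holds :: "'a add_structure \<Rightarrow> fm \<Rightarrow> bool" where
  "holds S p \<longleftrightarrow> (\<forall>e. range e \<subseteq> univ S \<longrightarrow> sat S e p)"

definition theory_of :: "'a add_structure \<Rightarrow> fm set" where
  "theory_of S = {p. sentence p \<and> holds S p}"

definition is_model :: "'a add_structure \<Rightarrow> fm set \<Rightarrow> bool" where
  "is_model S T \<longleftrightarrow> is_structure S \<and> (\<forall>p\<in>T. holds S p)"

definition isomorphic :: "'a add_structure \<Rightarrow> 'b add_structure \<Rightarrow> bool" where
  "isomorphic S T \<longleftrightarrow>
     (\<exists>f. bij_betw f (univ S) (univ T) \<and>
          (\<forall>x\<in>univ S. \<forall>y\<in>univ S. f (add S x y) = add T (f x) (f y)))"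


section \<open>Presburger arithmetic\<close>

definition nat_add :: "nat add_structure" where
  "nat_add = \<lparr>univ = UNIV, add = (+)\<rparr>"

definition PrA :: "fm set" where
  "PrA = theory_of nat_add"


section \<open>Multi-dimensional interpretations\<close>

text \<open>
  In an \<open>m\<close>-dimensional translation, the \<open>j\<close>-th component of the \<open>i\<close>-th tuple of
  variables (both counted from 0) is the variable \<open>i * m + j\<close>.  Accordingly a formula
  is evaluated at a sequence of \<open>m\<close>-tuples by concatenating them.
\<close>

record translation =
  Dom :: fm
  Pred_eq :: fm
  Fun_add :: fm

definition is_translation :: "nat \<Rightarrow> translation \<Rightarrow> bool" where
  "is_translation m \<iota> \<longleftrightarrow>
     free_vars (Dom \<iota>) \<subseteq> {..<m} \<and>
     free_vars (Pred_eq \<iota>) \<subseteq> {..<2 * m} \<and>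
     free_vars (Fun_add \<iota>) \<subseteq> {..<3 * m}"

text \<open>
  Entries \<open>xs ! i\<close> with \<open>i \<ge> length xs\<close> are unspecified; they are irrelevant
  for formulas whose free variables are below \<open>length xs\<close>.
\<close>

definition sat_at :: "'b add_structure \<Rightarrow> fm \<Rightarrow> 'b list \<Rightarrow> bool" where
  "sat_at B p xs \<longleftrightarrow> sat B (\<lambda>i. xs ! i) p"

definition int_dom :: "nat \<Rightarrow> translation \<Rightarrow> 'b add_structure \<Rightarrow> 'b list set" where
  "int_dom m \<iota> B =
     {b. length b = m \<and> set b \<subseteq> univ B \<and> sat_at B (Dom \<iota>) b}"

definition int_rel :: "nat \<Rightarrow> translation \<Rightarrow> 'b add_structure \<Rightarrow> ('b list \<times> 'b list) set" where
  "int_rel m \<iota> B =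
     {(b1, b2). b1 \<in> int_dom m \<iota> B \<and> b2 \<in> int_dom m \<iota> B \<and>
                sat_at B (Pred_eq \<iota>) (b1 @ b2)}"

definition is_interpretation ::
  "nat \<Rightarrow> translation \<Rightarrow> 'a add_structure \<Rightarrow> 'b add_structure \<Rightarrow> bool" where
  "is_interpretation m \<iota> A B \<longleftrightarrow>
     is_translation m \<iota> \<and>
     int_dom m \<iota> B \<noteq> {} \<and>
     equiv (int_dom m \<iota> B) (int_rel m \<iota> B) \<and>
     (\<exists>h. bij_betw h (int_dom m \<iota> B // int_rel m \<iota> B) (univ A) \<and>
          (\<forall>b0\<in>int_dom m \<iota> B. \<forall>b1\<in>int_dom m \<iota> B. \<forall>b2\<in>int_dom m \<iota> B.
             h (int_rel m \<iota> B `` {b0}) =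
               add A (h (int_rel m \<iota> B `` {b1})) (h (int_rel m \<iota> B `` {b2}))
             \<longleftrightarrow> sat_at B (Fun_add \<iota>) (b0 @ b1 @ b2)))"

definition interpreted_in :: "nat \<Rightarrow> 'a add_structure \<Rightarrow> 'b add_structure \<Rightarrow> bool" where
  "interpreted_in m A B \<longleftrightarrow> (\<exists>\<iota>. is_interpretation m \<iota> A B)"

end

theory Submission
  imports "HOL-Decision_Procs.Cooper" Defs
begin

text \<open>
  In a model of Presburger arithmetic call \<open>x\<close> far below \<open>y\<close> if the interval between them is
  infinite.  Halving shows that this is a dense strict weak order, and if it is empty then the
  model is standard.  For an interpreted model, an interval is finite iff its elements have
  representatives of bounded norm, so the order is definable in \<open>(\<nat>, +)\<close> on \<open>m\<close>-tuples.

  A definable dense strict weak order on \<open>m\<close>-tuples is empty, by counting.  Let \<open>x\<close>, \<open>y\<close> be related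
  tuples of norm at most \<open>n\<close>.  The least norms of the classes between them form an infinite set
  definable from \<open>x\<close> and \<open>y\<close>.  Quantifier elimination makes it periodic, with a period independent
  of \<open>x\<close> and \<open>y\<close>, above a bound linear in \<open>n\<close>; hence there are \<open>n\<close> pairwise inequivalent elements
  between \<open>x\<close> and \<open>y\<close> of norm \<open>O(n)\<close>.  Iterating this \<open>m + 1\<close> times gives \<open>n ^ (m + 1)\<close> elements of
  norm \<open>O(n)\<close>, but there are only \<open>O(n ^ m)\<close> such tuples.
\<close>

section \<open>Periodicity of definable sets\<close>

primrec num_of :: "(nat \<Rightarrow> nat) \<Rightarrow> tm \<Rightarrow> num" where
  "num_of \<rho> (Var v) = Bound (\<rho> v)"
| "num_of \<rho> (Plus s t) = num.Add (num_of \<rho> s) (num_of \<rho> t)"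

text \<open>The target logic has de Bruijn indices over the integers: \<open>\<rho>\<close> tracks
  the index of each named variable, a quantifier gives its variable index 0 and shifts the others,
  and \<open>Ge (Bound 0)\<close> restricts it to the natural numbers.\<close>

primrec fm_of :: "(nat \<Rightarrow> nat) \<Rightarrow> Defs.fm \<Rightarrow> Cooper.fm" where
  "fm_of \<rho> (Defs.Eq s t) = Cooper.Eq (Sub (num_of \<rho> s) (num_of \<rho> t))"
| "fm_of \<rho> (Defs.Neg p) = Cooper.Not (fm_of \<rho> p)"
| "fm_of \<rho> (Conj p q) = And (fm_of \<rho> p) (fm_of \<rho> q)"
| "fm_of \<rho> (Ex x p) = E (And (Ge (Bound 0)) (fm_of (\<lambda>v. if v = x then 0 else Suc (\<rho> v)) p))"

lemma Inum_num_of: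
  assumes "\<forall>v\<in>tm_vars t. bs ! \<rho> v = int (e v)"
  shows "Inum bs (num_of \<rho> t) = int (tm_val nat_add e t)"
  using assms by (induction t) (auto simp: nat_add_def)

lemma Ifm_fm_of:
  assumes "\<forall>v\<in>free_vars p. bs ! \<rho> v = int (e v)"
  shows "Ifm bbs bs (fm_of \<rho> p) \<longleftrightarrow> sat nat_add e p"
  using assms
proof (induction p arbitrary: \<rho> bs e)
  case (Eq s t)
  then show ?case by (simp add: Inum_num_of[of _ bs \<rho> e])
next
  case (Ex x p)
  let ?\<rho> = "\<lambda>v. if v = x then 0 else Suc (\<rho> v)"
  have "Ifm bbs (int a # bs) (fm_of ?\<rho> p) \<longleftrightarrow> sat nat_add (e(x := a)) p" for a
    using Ex.prems by (intro Ex.IH) auto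
  moreover have "(\<exists>z\<ge>0. Q z) \<longleftrightarrow> (\<exists>a. Q (int a))" for Q :: "int \<Rightarrow> bool"
    by (metis int_nat_eq of_nat_0_le_iff)
  ultimately show ?case by (simp add: nat_add_def)
next
  case (Conj p q)
  then have "Ifm bbs bs (fm_of \<rho> p) = sat nat_add e p" "Ifm bbs bs (fm_of \<rho> q) = sat nat_add e q"
    by auto
  then show ?case by simp
qed auto

lemma finite_free_vars: "finite (free_vars p)"
proof (induction p)
  have "finite (tm_vars t)" for t by (induction t) auto
  then show "finite (free_vars (Defs.Eq s t))" for s t by simp
qed auto

section \<open>Terms as affine functions of one variable\<close>

definition env_upto :: "nat \<Rightarrow> (nat \<Rightarrow> nat) \<Rightarrow> int list" where
  "env_upto M e = map (\<lambda>v. int (e v)) [0..<M]"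

definition other_sum :: "nat \<Rightarrow> nat \<Rightarrow> (nat \<Rightarrow> nat) \<Rightarrow> nat" where
  "other_sum x M e = (\<Sum>v\<in>{..<M} - {x}. e v)"

text \<open>Two features drive periodicity: the slope \<open>a\<close> does not depend on the
  environment, and the value at \<open>x = 0\<close> grows at most linearly in the other variables.
  The summand 1 absorbs constants.\<close>

definition affine_in :: "nat \<Rightarrow> int \<Rightarrow> nat \<Rightarrow> nat \<Rightarrow> num \<Rightarrow> bool" where
  "affine_in x a K M t \<longleftrightarrow> (\<forall>e k.
     Inum (env_upto M (e(x := k))) t = Inum (env_upto M (e(x := 0))) t + a * int k \<and>
     \<bar>Inum (env_upto M (e(x := 0))) t\<bar> \<le> int K * (1 + int (other_sum x M e)))"

lemma affine_in_cong:
  assumes "\<And>bs. Inum bs t = Inum bs t'" "affine_in x a K M t'"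
  shows "affine_in x a K M t"
  using assms(2) unfolding affine_in_def assms(1) .

lemma affine_in_const: "affine_in x 0 (nat \<bar>c\<bar>) M (C c)"
proof -
  have "\<bar>c\<bar> \<le> \<bar>c\<bar> * (1 + int (other_sum x M e))" for e
    by (simp add: mult_le_cancel_left1)
  then show ?thesis by (auto simp: affine_in_def)
qed

lemma affine_in_Bound:
  assumes "v < M"
  shows "affine_in x (if v = x then 1 else 0) 1 M (Bound v)"
proof -
  have nth: "env_upto M e ! v = int (e v)" for e
    using assms by (simp add: env_upto_def)
  have "e v \<le> other_sum x M e" if "v \<noteq> x" for e
    unfolding other_sum_def using assms that by (intro member_le_sum) auto
  then have "int (e v) \<le> 1 + int (other_sum x M e)" if "v \<noteq> x" for e
    using that by (metis le_SucI of_nat_Suc of_nat_mono)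
  then show ?thesis by (simp add: affine_in_def nth)
qed

lemma affine_in_Add:
  assumes "affine_in x a K M s" "affine_in x b L M t"
  shows "affine_in x (a + b) (K + L) M (num.Add s t)"
  unfolding affine_in_def
proof (intro allI)
  fix e k
  let ?I = "\<lambda>k. Inum (env_upto M (e(x := k)))" and ?S = "1 + int (other_sum x M e)"
  have "?I k s = ?I 0 s + a * int k" "\<bar>?I 0 s\<bar> \<le> int K * ?S"
    "?I k t = ?I 0 t + b * int k" "\<bar>?I 0 t\<bar> \<le> int L * ?S"
    using assms unfolding affine_in_def by blast+
  moreover have "int (K + L) * ?S = int K * ?S + int L * ?S"
    by (simp only: of_nat_add distrib_right)
  ultimately show "?I k (num.Add s t) = ?I 0 (num.Add s t) + (a + b) * int k \<and>
      \<bar>?I 0 (num.Add s t)\<bar> \<le> int (K + L) * ?S"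
    unfolding Inum.simps distrib_right[of a b] by linarith
qed

lemma affine_in_Mul:
  assumes "affine_in x a K M t"
  shows "affine_in x (c * a) (nat \<bar>c\<bar> * K) M (Mul c t)"
  unfolding affine_in_def
proof (intro allI conjI)
  fix e k
  let ?I = "\<lambda>k. Inum (env_upto M (e(x := k)))" and ?S = "1 + int (other_sum x M e)"
  have *: "?I k t = ?I 0 t + a * int k" "\<bar>?I 0 t\<bar> \<le> int K * ?S"
    using assms unfolding affine_in_def by blast+
  show "?I k (Mul c t) = ?I 0 (Mul c t) + c * a * int k"
    using *(1) by (simp add: distrib_left mult.assoc)
  show "\<bar>?I 0 (Mul c t)\<bar> \<le> int (nat \<bar>c\<bar> * K) * ?S"
    using mult_left_mono[OF *(2), of "\<bar>c\<bar>"] by (simp add: abs_mult mult.assoc)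
qed

text \<open>\<open>M0\<close> keeps every index of \<open>t\<close> inside the list; entries past
  the end are unspecified.\<close>

lemma Inum_affine: "\<exists>a K M0. \<forall>M\<ge>M0. affine_in x a K M t"
proof (induction t)
  case (C c)
  then show ?case using affine_in_const by blast
next
  case (Bound v)
  then show ?case using affine_in_Bound by (metis Suc_le_lessD)
next
  case (Mul c t)
  then show ?case using affine_in_Mul by metis
next
  case (Neg t)
  then obtain a K M0 where *: "\<forall>M\<ge>M0. affine_in x a K M t" by blast
  have "affine_in x (- 1 * a) (nat \<bar>- 1\<bar> * K) M (num.Neg t)" if "M \<ge> M0" for M
    by (rule affine_in_cong[OF _ affine_in_Mul]) (use * that in auto)
  then show ?case by blast
next
  case (Add s t)
  then obtain a K M0 b L M1 where "\<forall>M\<ge>M0. affine_in x a K M s" "\<forall>M\<ge>M1. affine_in x b L M t"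
    by blast
  then have "\<forall>M\<ge>max M0 M1. affine_in x (a + b) (K + L) M (num.Add s t)"
    by (auto intro: affine_in_Add)
  then show ?case by blast
next
  case (Sub s t)
  then obtain a K M0 b L M1 where *: "\<forall>M\<ge>M0. affine_in x a K M s" "\<forall>M\<ge>M1. affine_in x b L M t"
    by blast
  have "affine_in x (a + - 1 * b) (K + nat \<bar>- 1\<bar> * L) M (Sub s t)" if "M \<ge> max M0 M1" for M
    by (rule affine_in_cong[OF _ affine_in_Add[OF _ affine_in_Mul]]) (use * that in auto)
  then show ?case by blast
next
  case (CN v c t)
  then obtain a K M0 where *: "\<forall>M\<ge>M0. affine_in x a K M t" by blast
  have "affine_in x (c * (if v = x then 1 else 0) + a) (nat \<bar>c\<bar> * 1 + K) M (CN v c t)"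
    if "M \<ge> max M0 (Suc v)" for M
    by (rule affine_in_cong[OF _ affine_in_Add[OF affine_in_Mul[OF affine_in_Bound]]])
      (use * that in auto)
  then show ?case by blast
qed

section \<open>Eventual periodicity of formulas in one variable\<close>

definition periodic_in :: "nat \<Rightarrow> Cooper.fm \<Rightarrow> bool" where
  "periodic_in x p \<longleftrightarrow> (\<exists>C N M0. N > 0 \<and> (\<forall>M\<ge>M0. \<forall>e k. e x > C * (1 + other_sum x M e) \<longrightarrow>
     Ifm [] (env_upto M (e(x := e x + N * k))) p = Ifm [] (env_upto M e) p))"

text \<open>An atom is decided by the sign of its term and its residue modulo some \<open>d\<close>.
  Far out the sign no longer changes, and a shift of \<open>x\<close> by a multiple of
  \<open>nat \<bar>d\<bar>\<close> changes the term by a multiple of \<open>d\<close>.\<close>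

lemma periodic_in_atom:
  assumes "\<And>bs. Ifm [] bs p = Q (Inum bs t)"
    and "\<And>v w. sgn v = sgn w \<Longrightarrow> d dvd (v - w) \<Longrightarrow> Q v = Q w"
    and "d \<noteq> (0::int)"
  shows "periodic_in x p"
proof -
  obtain a K M0 where *: "\<forall>M\<ge>M0. affine_in x a K M t"
    using Inum_affine by blast
  \<comment> \<open>\<open>r\<close> stands for the value at \<open>x = 0\<close>. Beyond its bound,
    \<open>a * int u\<close> outweighs \<open>r\<close> unless \<open>a = 0\<close>, when the sign
    is that of \<open>r\<close> throughout.\<close>
  have sg: "sgn (r + a * int u) = sgn (r + a * int u')"
    if "\<bar>r\<bar> \<le> int K * (1 + int s)" "u > K * (1 + s)" "u' \<ge> u" for r u u' s
  proof -
    have "int K * (1 + int s) < int u"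
      using that(2) by (metis of_nat_1 of_nat_add of_nat_less_iff of_nat_mult)
    then have ru: "\<bar>r\<bar> < int u" "\<bar>r\<bar> < int u'" using that by linarith+
    consider "a = 0" | "a \<ge> 1" | "a \<le> -1" by linarith
    then show ?thesis
    proof cases
      case 2
      then have "int u \<le> a * int u" "int u' \<le> a * int u'" by (simp_all add: mult_le_cancel_right1)
      with ru have "r + a * int u > 0" "r + a * int u' > 0" by linarith+
      then show ?thesis by simp
    next
      case 3
      then have "1 * int u \<le> (-a) * int u" "1 * int u' \<le> (-a) * int u'"
        by (intro mult_right_mono; simp)+
      with ru have "r + a * int u < 0" "r + a * int u' < 0" by auto
      then show ?thesis by simp
    qed simp
  qed
  show ?thesis unfolding periodic_in_def
  proof (rule exI[of _ K], rule exI[of _ "nat \<bar>d\<bar>"], rule exI[of _ M0], intro conjI allI impI)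
    fix M e k assume M: "M0 \<le> M" and e: "e x > K * (1 + other_sum x M e)"
    let ?r = "Inum (env_upto M (e(x := 0))) t"
    have eq: "Inum (env_upto M (e(x := k))) t = ?r + a * int k" for k
      using * M unfolding affine_in_def by blast
    have "\<bar>?r\<bar> \<le> int K * (1 + int (other_sum x M e))"
      using * M unfolding affine_in_def by blast
    from sg[OF this e] eq have "sgn (Inum (env_upto M (e(x := e x + nat \<bar>d\<bar> * k))) t)
        = sgn (Inum (env_upto M (e(x := e x))) t)"
      by (metis le_add1)
    moreover have "Inum (env_upto M (e(x := e x + nat \<bar>d\<bar> * k))) t - Inum (env_upto M (e(x := e x))) t
       = d * (sgn d * a * int k)"
      unfolding eq[of "e x"] eq[of "e x + nat \<bar>d\<bar> * k"]
      by (cases "d \<ge> 0") (auto simp: algebra_simps sgn_if)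
    ultimately show "Ifm [] (env_upto M (e(x := e x + nat \<bar>d\<bar> * k))) p = Ifm [] (env_upto M e) p"
      unfolding assms(1) by (metis assms(2) dvd_triv_left fun_upd_triv)
  qed (use assms(3) in auto)
qed

lemma periodic_in_combine:
  assumes "periodic_in x p" "periodic_in x q"
    and "\<And>bs. Ifm [] bs r = f (Ifm [] bs p) (Ifm [] bs q)"
  shows "periodic_in x r"
proof -
  obtain C N M0 C' N' M1 where *: "N > 0" "N' > 0"
    "\<And>M e k. M \<ge> M0 \<Longrightarrow> e x > C * (1 + other_sum x M e) \<Longrightarrow>
       Ifm [] (env_upto M (e(x := e x + N * k))) p = Ifm [] (env_upto M e) p"
    "\<And>M e k. M \<ge> M1 \<Longrightarrow> e x > C' * (1 + other_sum x M e) \<Longrightarrow>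
       Ifm [] (env_upto M (e(x := e x + N' * k))) q = Ifm [] (env_upto M e) q"
    using assms(1,2) unfolding periodic_in_def by metis
  show ?thesis unfolding periodic_in_def
  proof (rule exI[of _ "C + C'"], rule exI[of _ "N * N'"], rule exI[of _ "max M0 M1"], intro conjI allI impI)
    fix M e k assume M: "max M0 M1 \<le> M" and e: "e x > (C + C') * (1 + other_sum x M e)"
    have "Ifm [] (env_upto M (e(x := e x + N * (N' * k)))) p = Ifm [] (env_upto M e) p"
      using M e by (intro *(3)) (auto simp: algebra_simps)
    moreover have "Ifm [] (env_upto M (e(x := e x + N' * (N * k)))) q = Ifm [] (env_upto M e) q"
      using M e by (intro *(4)) (auto simp: algebra_simps)
    ultimately show "Ifm [] (env_upto M (e(x := e x + N * N' * k))) r = Ifm [] (env_upto M e) r"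
      unfolding assms(3) by (simp add: mult.assoc mult.left_commute)
  qed (use * in auto)
qed

lemma periodic_in_const: "(\<And>bs bs'. Ifm [] bs p = Ifm [] bs' p) \<Longrightarrow> periodic_in x p"
  unfolding periodic_in_def by (rule exI[of _ 0], rule exI[of _ 1]) auto

text \<open>Divisibility by 0 means being 0, which the sign alone decides; the modulus 1 then stands
  in for 0, since \<open>periodic_in_atom\<close> asks for a nonzero \<open>d\<close>.\<close>

lemma dvd_cong_sgn:
  assumes "sgn v = sgn w" "(if i = 0 then 1 else i) dvd (v - w :: int)"
  shows "i dvd v \<longleftrightarrow> i dvd w"
proof (cases "i = 0")
  case True
  with assms(1) show ?thesis by (metis dvd_0_left_iff sgn_0_0)
next
  case False
  with assms(2) have "i dvd v - w" by simp
  then show ?thesis by (metis dvd_add_right_iff diff_add_cancel)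
qed

lemma periodic_in_qfree:
  assumes "qfree p"
  shows "periodic_in x p"
  using assms
proof (induction p)
  case (Lt t) show ?case
    by (rule periodic_in_atom[where t = t and Q = "\<lambda>z. z < 0" and d = 1]) (auto simp: sgn_if split: if_splits)
next
  case (Le t) show ?case
    by (rule periodic_in_atom[where t = t and Q = "\<lambda>z. z \<le> 0" and d = 1]) (auto simp: sgn_if split: if_splits)
next
  case (Gt t) show ?case
    by (rule periodic_in_atom[where t = t and Q = "\<lambda>z. z > 0" and d = 1]) (auto simp: sgn_if split: if_splits)
next
  case (Ge t) show ?case
    by (rule periodic_in_atom[where t = t and Q = "\<lambda>z. z \<ge> 0" and d = 1]) (auto simp: sgn_if split: if_splits)
next
  case (Eq t) show ?case
    by (rule periodic_in_atom[where t = t and Q = "\<lambda>z. z = 0" and d = 1]) (auto simp: sgn_if split: if_splits)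
next
  case (NEq t) show ?case
    by (rule periodic_in_atom[where t = t and Q = "\<lambda>z. z \<noteq> 0" and d = 1]) (auto simp: sgn_if split: if_splits)
next
  case (Dvd i t) show ?case
    by (rule periodic_in_atom[where t = t and Q = "\<lambda>z. i dvd z" and d = "if i = 0 then 1 else i"])
       (simp, erule (1) dvd_cong_sgn, simp)
next
  case (NDvd i t) show ?case
    by (rule periodic_in_atom[where t = t and Q = "\<lambda>z. \<not> i dvd z" and d = "if i = 0 then 1 else i"])
       (simp, drule (1) dvd_cong_sgn, simp_all)
next
  case (Not p) show ?case
    by (rule periodic_in_combine[where p = p and q = p and f = "\<lambda>u v. \<not> u"]) (use Not in auto)
next
  case (And p q) show ?case
    by (rule periodic_in_combine[where p = p and q = q and f = "(\<and>)"]) (use And in auto)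
next
  case (Or p q) show ?case
    by (rule periodic_in_combine[where p = p and q = q and f = "(\<or>)"]) (use Or in auto)
next
  case (Imp p q) show ?case
    by (rule periodic_in_combine[where p = p and q = q and f = "(\<longrightarrow>)"]) (use Imp in auto)
next
  case (Iff p q) show ?case
    by (rule periodic_in_combine[where p = p and q = q and f = "(=)"]) (use Iff in auto)
qed (auto intro: periodic_in_const)

text \<open>By \<open>mirqe\<close>, \<open>pa\<close> turns the translated formula into an
  equivalent quantifier-free one. The period \<open>N\<close> is uniform in the other variables;
  only the threshold depends on them, linearly.\<close>

lemma sat_eventually_periodic:
  "\<exists>C N M. N > 0 \<and> (\<forall>e k. e x > C * (1 + other_sum x M e) \<longrightarrow>
     sat nat_add (e(x := e x + N * k)) p = sat nat_add e p)"
proof -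
  obtain B where B: "\<And>v. v \<in> free_vars p \<Longrightarrow> v < B"
    using finite_free_vars finite_nat_set_iff_bounded by metis
  obtain C N M0 where *: "N > 0" "\<And>M e k. M \<ge> M0 \<Longrightarrow> e x > C * (1 + other_sum x M e) \<Longrightarrow>
     Ifm [] (env_upto M (e(x := e x + N * k))) (pa (fm_of id p)) = Ifm [] (env_upto M e) (pa (fm_of id p))"
    using periodic_in_qfree mirqe unfolding periodic_in_def by metis
  define M where "M = max M0 B"
  have "Ifm [] (env_upto M e) (pa (fm_of id p)) = sat nat_add e p" for e
    unfolding mirqe[THEN conjunct1] using B
    by (intro Ifm_fm_of) (force simp: env_upto_def M_def)
  moreover have "M \<ge> M0" by (simp add: M_def)
  ultimately show ?thesis using * by metis
qed

section \<open>Definable relations between tuples\<close>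

lemma tm_val_cong: "(\<And>v. v \<in> tm_vars t \<Longrightarrow> e v = e' v) \<Longrightarrow> tm_val S e t = tm_val S e' t"
  by (induction t) auto

lemma sat_cong: "(\<And>v. v \<in> free_vars p \<Longrightarrow> e v = e' v) \<Longrightarrow> sat S e p = sat S e' p"
proof (induction p arbitrary: e e')
  case (Eq s t)
  have "tm_val S e s = tm_val S e' s" "tm_val S e t = tm_val S e' t"
    by (rule tm_val_cong, rule Eq.prems, simp)+
  then show ?case by simp
next
  case (Neg p)
  have "sat S e p = sat S e' p"
    by (rule Neg.IH, rule Neg.prems, simp)
  then show ?case by simp
next
  case (Conj p q)
  have "sat S e p = sat S e' p" "sat S e q = sat S e' q"
    by (rule Conj.IH, rule Conj.prems, simp)+
  then show ?case by simp
next
  case (Ex x p)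
  have "sat S (e(x := a)) p = sat S (e'(x := a)) p" for a
    using Ex.prems by (intro Ex.IH) auto
  then show ?case by simp
qed

lemma tm_rename: "\<exists>t'. \<forall>e. tm_val S e t' = tm_val S (e \<circ> \<sigma>) t"
proof (induction t)
  case (Var x)
  then show ?case by (intro exI[of _ "Var (\<sigma> x)"]) simp
next
  case (Plus s t)
  then obtain s' t' where "\<forall>e. tm_val S e s' = tm_val S (e \<circ> \<sigma>) s"
    "\<forall>e. tm_val S e t' = tm_val S (e \<circ> \<sigma>) t" by blast
  then show ?case by (intro exI[of _ "Plus s' t'"]) (simp add: comp_def)
qed

lemma fm_rename: "\<exists>p'. \<forall>e. sat S e p' = sat S (e \<circ> \<sigma>) p"
proof (induction p arbitrary: \<sigma>)
  case (Eq s t)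
  obtain s' t' where "\<forall>e. tm_val S e s' = tm_val S (e \<circ> \<sigma>) s"
    "\<forall>e. tm_val S e t' = tm_val S (e \<circ> \<sigma>) t" using tm_rename by metis
  then show ?case by (intro exI[of _ "Defs.Eq s' t'"]) (simp add: comp_def)
next
  case (Neg p)
  then obtain p' where "\<forall>e. sat S e p' = sat S (e \<circ> \<sigma>) p" by blast
  then show ?case by (intro exI[of _ "Defs.Neg p'"]) (simp add: comp_def)
next
  case (Conj p q)
  obtain p' where "\<forall>e. sat S e p' = sat S (e \<circ> \<sigma>) p" using Conj.IH(1) by blast
  moreover obtain q' where "\<forall>e. sat S e q' = sat S (e \<circ> \<sigma>) q" using Conj.IH(2) by blast
  ultimately show ?case by (intro exI[of _ "Conj p' q'"]) (simp add: comp_def)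
next
  case (Ex x p)
  \<comment> \<open>\<open>y\<close> avoids the images of the free variables of \<open>p\<close>, so
    the new quantifier captures none of them, even if \<open>\<sigma>\<close> is not
    injective.\<close>
  obtain y where y: "y \<notin> \<sigma> ` free_vars p"
    using ex_new_if_finite[OF infinite_UNIV_nat finite_imageI[OF finite_free_vars]] by blast
  obtain p' where p': "\<forall>e. sat S e p' = sat S (e \<circ> \<sigma>(x := y)) p" using Ex.IH[of "\<sigma>(x := y)"] ..
  have "sat S (e(y := a) \<circ> \<sigma>(x := y)) p = sat S ((e \<circ> \<sigma>)(x := a)) p" for e a
    by (rule sat_cong) (use y in auto)
  with p' show ?case by (intro exI[of _ "Ex y p'"]) (simp add: comp_def)
qed

lemma sat_Ex_list:
  "sat nat_add e (foldr Ex vs p) \<longleftrightarrow> (\<exists>f. sat nat_add (\<lambda>v. if v \<in> set vs then f v else e v) p)"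
proof (induction vs arbitrary: e)
  case (Cons v vs)
  let ?upd = "\<lambda>vs f e w. if w \<in> set vs then f w else e w"
  have 1: "?upd vs f (e(v := a)) = ?upd (v # vs) (\<lambda>w. if w \<in> set vs then f w else a) e" for f a
    by (rule ext) auto
  have 2: "?upd (v # vs) f e = ?upd vs f (e(v := f v))" for f
    by (rule ext) auto
  have "(\<exists>a f. sat nat_add (?upd vs f (e(v := a))) p)
      \<longleftrightarrow> (\<exists>f. sat nat_add (?upd (v # vs) f e) p)"
  proof (intro iffI; elim exE)
    fix a f assume "sat nat_add (?upd vs f (e(v := a))) p"
    then show "\<exists>f. sat nat_add (?upd (v # vs) f e) p"
      unfolding 1 by (rule exI[of _ "\<lambda>w. if w \<in> set vs then f w else a"])
  next
    fix f assume "sat nat_add (?upd (v # vs) f e) p"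
    then show "\<exists>a f. sat nat_add (?upd vs f (e(v := a))) p"
      unfolding 2 by (intro exI[of _ "f v"] exI[of _ f])
  qed
  moreover have "sat nat_add e (foldr Ex (v # vs) p)
      \<longleftrightarrow> (\<exists>a f. sat nat_add (?upd vs f (e(v := a))) p)"
    using Cons.IH by (simp add: nat_add_def)
  ultimately show ?case by simp
qed simp

section \<open>Closure properties of definability on blocks of \<open>m\<close> variables\<close>

definition tuples :: "nat \<Rightarrow> (nat \<Rightarrow> nat) \<Rightarrow> nat \<Rightarrow> nat list" where
  "tuples m e i = map (\<lambda>j. e (i * m + j)) [0..<m]"

lemma length_tuples [simp]: "length (tuples m e i) = m"
  by (simp add: tuples_def)

text \<open>A relation receives the whole sequence of tuples, so arities stay implicit: projecting,
  permuting and quantifying are all changes of the sequence.\<close>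

definition definable :: "nat \<Rightarrow> ((nat \<Rightarrow> nat list) \<Rightarrow> bool) \<Rightarrow> bool" where
  "definable m R \<longleftrightarrow> (\<exists>p. \<forall>e. R (tuples m e) \<longleftrightarrow> sat nat_add e p)"

lemma definable_cong:
  assumes "definable m R" "\<And>\<tau>. (\<And>i. length (\<tau> i) = m) \<Longrightarrow> R \<tau> \<longleftrightarrow> R' \<tau>"
  shows "definable m R'"
  using assms unfolding definable_def by simp

lemma definable_neg: "definable m R \<Longrightarrow> definable m (\<lambda>\<tau>. \<not> R \<tau>)"
  unfolding definable_def by (metis sat.simps(2))

lemma definable_conj: "definable m R \<Longrightarrow> definable m Q \<Longrightarrow> definable m (\<lambda>\<tau>. R \<tau> \<and> Q \<tau>)"
  unfolding definable_def by (metis sat.simps(3))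

lemma definable_imp:
  assumes "definable m R" "definable m Q"
  shows "definable m (\<lambda>\<tau>. R \<tau> \<longrightarrow> Q \<tau>)"
  using definable_neg[OF definable_conj[OF assms(1) definable_neg[OF assms(2)]]] by simp

lemma definable_ex:
  assumes "definable m R"
  shows "definable m (\<lambda>\<tau>. \<exists>b. length b = m \<and> R (\<tau>(i := b)))"
proof -
  obtain p where p: "\<forall>e. R (tuples m e) \<longleftrightarrow> sat nat_add e p"
    using assms unfolding definable_def by blast
  let ?vs = "[i * m..<i * m + m]"
  let ?upd = "\<lambda>e f v. if v \<in> set ?vs then f v else e v"
  have upd: "tuples m (?upd e f) = (tuples m e)(i := map (\<lambda>j. f (i * m + j)) [0..<m])" for e f
  proof
    fix l
    have inj: "i = l" if "i * m \<le> l * m + j" "l * m + j < i * m + m" "j < m" for j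
    proof -
      have "l * m + j < (i + 1) * m" "i * m < (l + 1) * m" using that by auto
      then have "l < i + 1" "i < l + 1"
        by (meson le_add1 le_less_trans mult_less_cancel2)+
      then show ?thesis by simp
    qed
    then show "tuples m (?upd e f) l = ((tuples m e)(i := map (\<lambda>j. f (i * m + j)) [0..<m])) l"
      by (cases "l = i") (auto simp: tuples_def dest: inj)
  qed
  have "(\<exists>b. length b = m \<and> R ((tuples m e)(i := b))) \<longleftrightarrow> sat nat_add e (foldr Ex ?vs p)" for e
  proof -
    have "sat nat_add e (foldr Ex ?vs p) \<longleftrightarrow> (\<exists>f. R (tuples m (?upd e f)))"
      unfolding sat_Ex_list using p by blast
    also have "\<dots> \<longleftrightarrow> (\<exists>b. length b = m \<and> R ((tuples m e)(i := b)))"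
      unfolding upd
    proof (intro iffI; elim exE conjE)
      fix b assume b: "length b = m" "R ((tuples m e)(i := b))"
      have "map (\<lambda>j. b ! ((i * m + j) - i * m)) [0..<m] = b"
        using b(1) map_nth[of b] by simp
      with b(2) show "\<exists>f. R ((tuples m e)(i := map (\<lambda>j. f (i * m + j)) [0..<m]))"
        by (intro exI[of _ "\<lambda>v. b ! (v - i * m)"]) simp
    qed (metis length_map diff_zero length_upt)
    finally show ?thesis by simp
  qed
  then show ?thesis unfolding definable_def by blast
qed

lemma definable_all:
  assumes "definable m R"
  shows "definable m (\<lambda>\<tau>. \<forall>b. length b = m \<longrightarrow> R (\<tau>(i := b)))"
  using definable_neg[OF definable_ex[OF definable_neg[OF assms]], of i] by simp

lemma definable_rename:
  assumes "definable m R"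
  shows "definable m (\<lambda>\<tau>. R (\<lambda>i. \<tau> (\<sigma> i)))"
proof -
  obtain p where p: "\<forall>e. R (tuples m e) \<longleftrightarrow> sat nat_add e p"
    using assms unfolding definable_def by blast
  define \<rho> where "\<rho> v = \<sigma> (v div m) * m + v mod m" for v
  obtain p' where p': "\<forall>e. sat nat_add e p' = sat nat_add (e \<circ> \<rho>) p"
    using fm_rename by blast
  have "tuples m (e \<circ> \<rho>) = (\<lambda>i. tuples m e (\<sigma> i))" for e
    by (rule ext) (auto simp: tuples_def \<rho>_def)
  with p p' show ?thesis unfolding definable_def by metis
qed

text \<open>Links evaluation at concatenated tuples, as in translations, with assignments:
  \<open>k\<close> concatenated blocks list the values of the variables below
  \<open>k * m\<close>.\<close>

lemma definable_sat_at:
  assumes "free_vars p \<subseteq> {..<k * m}"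
  shows "definable m (\<lambda>\<tau>. sat_at nat_add p (concat (map \<tau> [0..<k])))"
proof -
  have "concat (map (tuples m e) [0..<k]) = map e [0..<k * m]" for e
  proof (induction k)
    case (Suc k)
    have "tuples m e k = map e [k * m..<k * m + m]"
      by (rule nth_equalityI) (auto simp: tuples_def)
    moreover have "[0..<Suc k * m] = [0..<k * m] @ [k * m..<k * m + m]"
      using upt_add_eq_append[of 0 "k * m" m] by (simp add: add.commute)
    ultimately show ?case using Suc by simp
  qed simp
  then have "sat_at nat_add p (concat (map (tuples m e) [0..<k])) = sat nat_add e p" for e
    unfolding sat_at_def by (intro sat_cong) (use assms in auto)
  then show ?thesis unfolding definable_def by blast
qed

lemma definable_norm_le: "definable m (\<lambda>\<tau>. sum_list (\<tau> 0) \<le> sum_list (\<tau> 1))"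
proof -
  let ?s = "\<lambda>vs t. foldr (\<lambda>v t. Plus (Var v) t) vs t"
  have s: "tm_val nat_add e (?s vs t) = sum_list (map e vs) + tm_val nat_add e t" for e vs t
    by (induction vs) (auto simp: nat_add_def)
  \<comment> \<open>Order and zero are expressed by addition: variable \<open>2 * m\<close> is the
    difference of the norms, and \<open>z + z = z\<close> forces variable \<open>2 * m + 1\<close>
    to be 0, so that it can end the second sum.\<close>
  let ?p = "Ex (2 * m) (Ex (2 * m + 1) (Conj
     (Defs.Eq (?s [0..<m] (Var (2 * m))) (?s [m..<m + m] (Var (2 * m + 1))))
     (Defs.Eq (Plus (Var (2 * m + 1)) (Var (2 * m + 1))) (Var (2 * m + 1)))))"
  have eq: "map (e(2 * m := a, 2 * m + 1 := b)) [0..<m] = tuples m e 0"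
    "map (e(2 * m := a, 2 * m + 1 := b)) [m..<m + m] = tuples m e 1" for e a b
    by (auto simp: tuples_def intro!: nth_equalityI)
  have "sum_list (tuples m e 0) \<le> sum_list (tuples m e 1) \<longleftrightarrow> sat nat_add e ?p" for e
    unfolding sat.simps s eq by (simp add: nat_add_def) (metis le_iff_add)
  then show ?thesis unfolding definable_def by blast
qed

lemma definable_subst1:
  assumes "definable m (\<lambda>\<tau>. P (\<tau> 0))"
  shows "definable m (\<lambda>\<tau>. P (\<tau> i))"
  using definable_rename[OF assms, of "\<lambda>_. i"] .

lemma definable_subst2:
  assumes "definable m (\<lambda>\<tau>. P (\<tau> 0) (\<tau> 1))"
  shows "definable m (\<lambda>\<tau>. P (\<tau> i) (\<tau> j))"
  using definable_rename[OF assms, of "\<lambda>k. if k = 0 then i else j"] by simp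

lemma definable_subst3:
  assumes "definable m (\<lambda>\<tau>. P (\<tau> 0) (\<tau> 1) (\<tau> 2))"
  shows "definable m (\<lambda>\<tau>. P (\<tau> i) (\<tau> j) (\<tau> k))"
  using definable_rename[OF assms, of "\<lambda>l. if l = 0 then i else if l = 1 then j else k"] by simp

text \<open>Varying only the first component of the third tuple, the others being zero, realises every
  norm, so a relation that depends on its third argument through the norm becomes a relation with
  a numerical argument.\<close>

lemma definable_eventually_periodic:
  assumes "definable m (\<lambda>\<tau>. R (\<tau> 0) (\<tau> 1) (\<tau> 2))" "0 < m"
  shows "\<exists>C N. N > 0 \<and> (\<forall>x y s k. length x = m \<longrightarrow> length y = m \<longrightarrow>
     s > C * (1 + sum_list x + sum_list y) \<longrightarrow>
     R x y ((s + N * k) # replicate (m - 1) 0) = R x y (s # replicate (m - 1) 0))"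
proof -
  obtain p where p: "\<And>e. R (tuples m e 0) (tuples m e 1) (tuples m e 2) \<longleftrightarrow> sat nat_add e p"
    using assms(1) unfolding definable_def by blast
  obtain C N M where *: "N > 0" "\<And>e k. e (2 * m) > C * (1 + other_sum (2 * m) M e) \<Longrightarrow>
     sat nat_add (e(2 * m := e (2 * m) + N * k)) p = sat nat_add e p"
    using sat_eventually_periodic by metis
  show ?thesis
  proof (rule exI[of _ C], rule exI[of _ N], intro conjI allI impI)
    fix x y :: "nat list" and s k
    assume xy: "length x = m" "length y = m" and s: "s > C * (1 + sum_list x + sum_list y)"
    define e where "e s v = (if v < m then x ! v else if v < 2 * m then y ! (v - m)
       else if v = 2 * m then s else 0)" for s v
    have t: "tuples m (e s) 0 = x" "tuples m (e s) 1 = y" "tuples m (e s) 2 = s # replicate (m - 1) 0" for s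
      using xy assms(2) by (auto simp: tuples_def e_def nth_Cons' intro!: nth_equalityI)
    \<comment> \<open>Apart from variable \<open>2 * m\<close>, only the variables below
      \<open>2 * m\<close> can be nonzero. They hold the entries of \<open>x\<close> and
      \<open>y\<close>, so the threshold becomes one in the norms.\<close>
    have "other_sum (2 * m) M (e s) = (\<Sum>v\<in>({..<M} - {2 * m}) \<inter> {..<2 * m}. e s v)"
      unfolding other_sum_def by (rule sum.mono_neutral_right) (auto simp: e_def)
    also have "\<dots> \<le> (\<Sum>v\<in>{..<2 * m}. e s v)"
      by (rule sum_mono2) auto
    also have "\<dots> = (\<Sum>v\<in>{0..<m}. e s v) + (\<Sum>v\<in>{0..<m}. e s (v + m))"
      using sum.atLeastLessThan_concat[of 0 m "2 * m" "e s"] sum.shift_bounds_nat_ivl[of "e s" 0 m m]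
      by (simp add: lessThan_atLeast0 mult_2)
    also have "\<dots> = sum_list x + sum_list y"
      unfolding sum_list_sum_nth using xy by (intro arg_cong2[where f = "(+)"] sum.cong) (auto simp: e_def)
    finally have "C * (1 + other_sum (2 * m) M (e s)) \<le> C * (1 + sum_list x + sum_list y)"
      by (intro mult_left_mono) (auto simp: mult.commute)
    then have "e s (2 * m) > C * (1 + other_sum (2 * m) M (e s))"
      using le_less_trans[OF _ s] by (simp add: e_def)
    moreover have "(e s)(2 * m := e s (2 * m) + N * k) = e (s + N * k)"
      by (rule ext) (simp add: e_def)
    ultimately have "sat nat_add (e (s + N * k)) p = sat nat_add (e s) p"
      using *(2) by metis
    then show "R x y ((s + N * k) # replicate (m - 1) 0) = R x y (s # replicate (m - 1) 0)"
      unfolding p[symmetric] t .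
  qed (fact *(1))
qed

section \<open>Definable dense orders\<close>

definition comparable_set :: "('a \<Rightarrow> 'a \<Rightarrow> bool) \<Rightarrow> 'a set \<Rightarrow> bool" where
  "comparable_set R X \<longleftrightarrow> (\<forall>a\<in>X. \<forall>b\<in>X. a \<noteq> b \<longrightarrow> R a b \<or> R b a)"

definition chain_between ::
  "('a \<Rightarrow> 'a \<Rightarrow> bool) \<Rightarrow> ('a \<Rightarrow> nat) \<Rightarrow> nat \<Rightarrow> 'a \<Rightarrow> 'a \<Rightarrow> 'a set \<Rightarrow> bool" where
  "chain_between R \<nu> B x y X \<longleftrightarrow>
     finite X \<and> comparable_set R X \<and> (\<forall>z\<in>X. R x z \<and> R z y \<and> \<nu> z \<le> B)"

lemma chain_between_mono:
  "chain_between R \<nu> B x y X \<Longrightarrow> B \<le> B' \<Longrightarrow> chain_between R \<nu> B' x y X"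
  unfolding chain_between_def by (meson order_trans)

lemma ex_maximal_element:
  assumes "transp R" "irreflp R" "finite W" "W \<noteq> {}"
  shows "\<exists>w\<in>W. \<forall>u\<in>W. \<not> R w u"
  using assms(3,4)
proof (induction rule: finite_ne_induct)
  case (insert x X)
  then obtain w where "w \<in> X" "\<forall>u\<in>X. \<not> R w u" by blast
  then show ?case using transpD[OF assms(1)] irreflpD[OF assms(2)]
    by (cases "R w x") (metis insert_iff)+
qed (use irreflpD[OF assms(2)] in simp)

text \<open>The members of \<open>Z\<close> serve as cuts: \<open>q\<close> elements go into the gap
  above each of them. The induction peels off a maximal \<open>z\<close>; the rest of
  \<open>Z\<close> handles the part below \<open>z\<close>, and \<open>gap\<close> fills the part
  between \<open>z\<close> and \<open>y\<close>.\<close>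

lemma chain_between_refine:
  assumes trans: "\<And>a b c. R a b \<Longrightarrow> R b c \<Longrightarrow> R a c"
    and irrefl: "\<And>a. \<not> R a a"
    and gap: "\<And>u w. R u w \<Longrightarrow> \<nu> u \<le> M \<Longrightarrow> \<nu> w \<le> M \<Longrightarrow> \<exists>X. chain_between R \<nu> B u w X \<and> q \<le> card X"
    and "chain_between R \<nu> M x y Z" "\<nu> y \<le> M"
  shows "\<exists>X. chain_between R \<nu> B x y X \<and> card Z * q \<le> card X"
  using assms(4,5)
proof (induction "card Z" arbitrary: Z y)
  case 0
  then show ?case by (intro exI[of _ "{}"]) (auto simp: chain_between_def comparable_set_def)
next
  case (Suc k)
  have fin: "finite Z" and Z: "Z \<noteq> {}" using Suc by (auto simp: chain_between_def)
  have "transp R" "irreflp R" using trans irrefl by (auto intro: transpI irreflpI)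
  then obtain z where z: "z \<in> Z" "\<forall>w\<in>Z. \<not> R z w"
    using ex_maximal_element fin Z by metis
  have zy: "R z y" "\<nu> z \<le> M" using Suc.prems z by (auto simp: chain_between_def)
  have "chain_between R \<nu> M x z (Z - {z})"
    using Suc.prems z by (fastforce simp: chain_between_def comparable_set_def)
  moreover have "card (Z - {z}) = k" using Suc.hyps(2) z fin by simp
  ultimately obtain X where X: "chain_between R \<nu> B x z X" "k * q \<le> card X"
    using Suc.hyps(1) zy by blast
  obtain Y where Y: "chain_between R \<nu> B z y Y" "q \<le> card Y"
    using gap[OF zy Suc.prems(2)] by blast
  have xz: "R x z" using Suc.prems z by (auto simp: chain_between_def)
  have FG: "R a b" if "a \<in> X" "b \<in> Y" for a b
    using that X Y trans unfolding chain_between_def by blast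
  then have disj: "X \<inter> Y = {}" using irrefl by blast
  have "comparable_set R (X \<union> Y)"
    using X(1) Y(1) FG unfolding chain_between_def comparable_set_def by (metis Un_iff)
  moreover have "R x u \<and> R u y \<and> \<nu> u \<le> B" if "u \<in> X \<union> Y" for u
    using that X(1) Y(1) trans[OF xz, of u] trans[OF _ zy(1), of u] unfolding chain_between_def
    by blast
  ultimately have "chain_between R \<nu> B x y (X \<union> Y)"
    using X(1) Y(1) unfolding chain_between_def by blast
  moreover have "card Z * q \<le> card (X \<union> Y)"
    using X Y disj Suc.hyps(2) by (simp add: card_Un_disjoint chain_between_def flip: Suc.hyps(2))
  ultimately show ?case by blast
qed

text \<open>Iterating the hypothesis \<open>step\<close> yields, for every \<open>j\<close>, chains of length \<open>n ^ j\<close> and norm linear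
  in \<open>n\<close>, too many for \<open>j > m\<close>.\<close>

lemma no_fast_growing_order:
  fixes R :: "nat list \<Rightarrow> nat list \<Rightarrow> bool" and C :: nat
  assumes len: "\<And>a b. R a b \<Longrightarrow> length a = m"
    and trans: "\<And>a b c. R a b \<Longrightarrow> R b c \<Longrightarrow> R a c"
    and irrefl: "\<And>a. \<not> R a a"
    and step: "\<And>n x y. R x y \<Longrightarrow> sum_list x \<le> n \<Longrightarrow> sum_list y \<le> n \<Longrightarrow>
       \<exists>Z. chain_between R sum_list (C * (n + 1)) x y Z \<and> card Z = n"
    and C: "1 \<le> C"
  shows "\<not> R x y"
proof
  assume R: "R x y"
  have chains: "\<exists>K. \<forall>n x y. R x y \<longrightarrow> sum_list x \<le> n \<longrightarrow> sum_list y \<le> n \<longrightarrow>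
     (\<exists>Z. chain_between R sum_list (K * (n + 1)) x y Z \<and> n ^ j \<le> card Z)" for j
  proof (induction j)
    case 0
    \<comment> \<open>\<open>n\<close> may be 0 while \<open>n ^ 0 = 1\<close>, so
      \<open>step\<close> is used at \<open>n + 1\<close>; the factor 2 pays for this.\<close>
    show ?case
    proof (intro exI[of _ "C * 2"] allI impI)
      fix n x y assume xy: "R x y" "sum_list x \<le> n" "sum_list y \<le> n"
      have "\<exists>Z. chain_between R sum_list (C * (n + 1 + 1)) x y Z \<and> card Z = n + 1"
        by (rule step[OF xy(1)]) (use xy(2,3) in linarith)+
      then obtain Z where Z: "chain_between R sum_list (C * (n + 1 + 1)) x y Z \<and> card Z = n + 1" ..
      have "C * (n + 1 + 1) \<le> C * 2 * (n + 1)"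
        unfolding mult.assoc by (rule mult_le_mono2) simp
      from chain_between_mono[OF conjunct1[OF Z] this] Z
      show "\<exists>Z. chain_between R sum_list (C * 2 * (n + 1)) x y Z \<and> n ^ 0 \<le> card Z"
        by (intro exI[of _ Z]) simp
    qed
  next
    case (Suc j)
    then obtain K where K: "\<And>n x y. R x y \<Longrightarrow> sum_list x \<le> n \<Longrightarrow> sum_list y \<le> n \<Longrightarrow>
     \<exists>Z. chain_between R sum_list (K * (n + 1)) x y Z \<and> n ^ j \<le> card Z" by blast
    show ?case
    proof (intro exI[of _ "K * (C + 1)"] allI impI)
      fix n x y assume xy: "R x y" "sum_list x \<le> n" "sum_list y \<le> n"
      \<comment> \<open>\<open>M\<close> bounds the norms of the cuts, so the induction hypothesis
        is applied at \<open>M\<close>. It gives \<open>M ^ j\<close> elements per gap, which is at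
        least \<open>n ^ j\<close> because \<open>n \<le> M\<close>.\<close>
      define M where "M = C * (n + 1)"
      have nM: "n \<le> M" using mult_le_mono1[OF C, of "n + 1"] by (simp add: M_def)
      obtain Z where Z: "chain_between R sum_list M x y Z" "card Z = n"
        using step[OF xy] unfolding M_def by blast
      have "\<exists>X. chain_between R sum_list (K * (M + 1)) x y X \<and> card Z * n ^ j \<le> card X"
      proof (rule chain_between_refine[where R = R and M = M])
        fix u w assume "R u w" "sum_list u \<le> M" "sum_list w \<le> M"
        then show "\<exists>X. chain_between R sum_list (K * (M + 1)) u w X \<and> n ^ j \<le> card X"
          using K power_mono[OF nM, of j] by (meson order_trans zero_le)
      qed (use trans irrefl Z nM xy in auto)
      then obtain X where X: "chain_between R sum_list (K * (M + 1)) x y X" "card Z * n ^ j \<le> card X"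
        by blast
      have "M + 1 \<le> (C + 1) * (n + 1)" by (simp add: M_def)
      then have "K * (M + 1) \<le> K * (C + 1) * (n + 1)"
        unfolding mult.assoc by (rule mult_le_mono2)
      with X Z(2) show "\<exists>Z. chain_between R sum_list (K * (C + 1) * (n + 1)) x y Z \<and> n ^ Suc j \<le> card Z"
        by (intro exI[of _ X] conjI chain_between_mono[OF X(1)]) simp_all
    qed
  qed
  obtain K where K: "\<And>n x y. R x y \<Longrightarrow> sum_list x \<le> n \<Longrightarrow> sum_list y \<le> n \<Longrightarrow>
     \<exists>Z. chain_between R sum_list (K * (n + 1)) x y Z \<and> n ^ Suc m \<le> card Z"
    using chains[of "Suc m"] by blast
  \<comment> \<open>The norms are included so that \<open>K\<close> applies to \<open>x\<close> and
    \<open>y\<close>; the rest makes \<open>n\<close> exceed \<open>(2 * K + 1) ^ m\<close>, so that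
    \<open>n ^ Suc m\<close> elements outnumber the available tuples.\<close>
  define n where "n = sum_list x + sum_list y + (2 * K + 1) ^ m + 1"
  obtain Z where Z: "chain_between R sum_list (K * (n + 1)) x y Z" "n ^ Suc m \<le> card Z"
    using K[OF R, of n] by (auto simp: n_def)
  have "Z \<subseteq> {xs. set xs \<subseteq> {..K * (n + 1)} \<and> length xs = m}"
  proof
    fix z assume "z \<in> Z"
    then have "R z y" "sum_list z \<le> K * (n + 1)" using Z(1) unfolding chain_between_def by blast+
    then show "z \<in> {xs. set xs \<subseteq> {..K * (n + 1)} \<and> length xs = m}"
      using len member_le_sum_list[of _ z] by (auto intro: order_trans)
  qed
  from card_mono[OF finite_lists_length_eq[OF finite_atMost] this]
  have "card Z \<le> card {..K * (n + 1)} ^ m"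
    unfolding card_lists_length_eq[OF finite_atMost] .
  also have "\<dots> \<le> ((2 * K + 1) * n) ^ m"
  proof (rule power_mono)
    have "1 \<le> n" by (simp add: n_def)
    then have "1 * K \<le> n * K" by (rule mult_le_mono1)
    moreover have "card {..K * (n + 1)} = n * K + K + 1" "(2 * K + 1) * n = 2 * (n * K) + n"
      by (simp_all add: algebra_simps)
    ultimately show "card {..K * (n + 1)} \<le> (2 * K + 1) * n"
      using \<open>1 \<le> n\<close> by linarith
  qed simp
  finally have "n ^ Suc m \<le> ((2 * K + 1) * n) ^ m" using Z(2) by (rule order_trans[rotated])
  then have "n * n ^ m \<le> (2 * K + 1) ^ m * n ^ m"
    unfolding power_mult_distrib power_Suc .
  moreover have "n ^ m > 0" by (simp add: n_def)
  ultimately have "n \<le> (2 * K + 1) ^ m" unfolding mult_le_cancel2 by blast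
  then show False by (simp add: n_def)
qed

section \<open>Least norms in a definable dense order\<close>

lemma finite_bounded_sum_list: "finite {w :: nat list. length w = m \<and> sum_list w \<le> b}"
  by (rule finite_subset[OF _ finite_lists_length_eq[of "{..b}" m]])
    (auto intro: order_trans[OF member_le_sum_list])

text \<open>\<open>negtrans\<close> makes incomparability an equivalence relation on
  \<open>D\<close>, so \<open>R\<close> orders its classes linearly.\<close>

locale definable_dense_order =
  fixes m :: nat and D :: "nat list set" and R :: "nat list \<Rightarrow> nat list \<Rightarrow> bool"
  assumes dom_len: "\<And>a. a \<in> D \<Longrightarrow> length a = m"
    and dom_definable: "definable m (\<lambda>\<tau>. \<tau> 0 \<in> D)"
    and R_definable: "definable m (\<lambda>\<tau>. R (\<tau> 0) (\<tau> 1))"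
    and R_dom: "\<And>a b. R a b \<Longrightarrow> a \<in> D \<and> b \<in> D"
    and irrefl: "\<And>a. \<not> R a a"
    and trans: "\<And>a b c. R a b \<Longrightarrow> R b c \<Longrightarrow> R a c"
    and negtrans: "\<And>a b c. R a b \<Longrightarrow> c \<in> D \<Longrightarrow> R a c \<or> R c b"
    and dense: "\<And>a b. R a b \<Longrightarrow> \<exists>c. R a c \<and> R c b"
begin

definition least_norm :: "nat list \<Rightarrow> bool" where
  "least_norm z \<longleftrightarrow> (\<forall>w\<in>D. \<not> R z w \<longrightarrow> \<not> R w z \<longrightarrow> sum_list z \<le> sum_list w)"

text \<open>\<open>t\<close> matters through its norm only: it codes a number as a tuple, which
  makes the set of least norms between \<open>x\<close> and \<open>y\<close> a relation between
  tuples.\<close>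

definition norm_between :: "nat list \<Rightarrow> nat list \<Rightarrow> nat list \<Rightarrow> bool" where
  "norm_between x y t \<longleftrightarrow> (\<exists>z. R x z \<and> R z y \<and> least_norm z \<and> sum_list z = sum_list t)"

lemma norm_between_definable: "definable m (\<lambda>\<tau>. norm_between (\<tau> 0) (\<tau> 1) (\<tau> 2))"
proof -
  note Rd = definable_subst2[where P = R, OF R_definable]
  note Dd = definable_subst1[where P = "\<lambda>a. a \<in> D", OF dom_definable]
  note le = definable_subst2[where m = m and P = "\<lambda>a b. sum_list a \<le> sum_list b", OF definable_norm_le]
  have "definable m (\<lambda>\<tau>. \<forall>w. length w = m \<longrightarrow> w \<in> D \<longrightarrow> \<not> R (\<tau> 0) w \<longrightarrow> \<not> R w (\<tau> 0) \<longrightarrow>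
      sum_list (\<tau> 0) \<le> sum_list w)"
    using definable_all[OF definable_imp[OF Dd[of 1] definable_imp[OF definable_neg[OF Rd[of 0 1]]
       definable_imp[OF definable_neg[OF Rd[of 1 0]] le[of 0 1]]]], of 1]
    by simp
  then have "definable m (\<lambda>\<tau>. least_norm (\<tau> 0))"
    by (rule definable_cong) (auto simp: least_norm_def dom_len)
  note Md = definable_subst1[where P = least_norm, OF this]
  have "definable m (\<lambda>\<tau>. \<exists>z. length z = m \<and> R (\<tau> 0) z \<and> R z (\<tau> 1) \<and> least_norm z \<and>
      sum_list z \<le> sum_list (\<tau> 2) \<and> sum_list (\<tau> 2) \<le> sum_list z)"
    using definable_ex[OF definable_conj[OF Rd[of 0 3] definable_conj[OF Rd[of 3 1]
       definable_conj[OF Md[of 3] definable_conj[OF le[of 3 2] le[of 2 3]]]]], of 3]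
    by simp
  moreover have "length z = m \<and> R x z \<and> R z y \<and> least_norm z \<and>
      sum_list z \<le> sum_list t \<and> sum_list t \<le> sum_list z \<longleftrightarrow>
      R x z \<and> R z y \<and> least_norm z \<and> sum_list z = sum_list t" for x y z t
    using R_dom[of x z] dom_len[of z] by auto
  ultimately show ?thesis by (simp only: norm_between_def)
qed

lemma ex_least_norm:
  assumes "z \<in> D"
  obtains w where "w \<in> D" "\<not> R z w" "\<not> R w z" "least_norm w"
proof -
  let ?P = "\<lambda>w. w \<in> D \<and> \<not> R z w \<and> \<not> R w z"
  have "?P z" using assms irrefl by blast
  then obtain w where w: "?P w" "\<And>u. ?P u \<Longrightarrow> sum_list w \<le> sum_list u"
    using ex_has_least_nat[of ?P z sum_list] by blast
  \<comment> \<open>By \<open>negtrans\<close>, whatever is incomparable with \<open>w\<close> is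
    incomparable with \<open>z\<close>, so the minimum over the class of \<open>z\<close> is also
    that over the class of \<open>w\<close>.\<close>
  have "least_norm w" unfolding least_norm_def using w negtrans assms by metis
  with w that show thesis by blast
qed

text \<open>With least norms bounded by \<open>b\<close>, a finite set of tuples would represent all
  classes between \<open>x\<close> and \<open>y\<close>. Density gives a \<open>z\<close> above a
  maximal representative, and a representative of the class of \<open>z\<close> would lie above it
  too.\<close>

lemma norm_between_unbounded:
  assumes "R x y"
  shows "\<exists>z. R x z \<and> R z y \<and> least_norm z \<and> b < sum_list z"
proof (rule ccontr)
  assume neg: "\<not> ?thesis"
  define W where "W = {w. R x w \<and> R w y \<and> sum_list w \<le> b}"
  have "W \<subseteq> {w. length w = m \<and> sum_list w \<le> b}"
    unfolding W_def using R_dom dom_len by blast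
  then have fin: "finite W" using finite_bounded_sum_list finite_subset by blast
  have W: "\<exists>w\<in>W. \<not> R z w \<and> \<not> R w z" if z: "R x z" "R z y" for z
  proof -
    obtain w where w: "w \<in> D" "\<not> R z w" "\<not> R w z" "least_norm w"
      using ex_least_norm R_dom[OF z(1)] by blast
    have xwy: "R x w" "R w y"
      using negtrans[OF z(1) w(1)] negtrans[OF z(2) w(1)] w(2,3) by blast+
    then have "sum_list w \<le> b" using neg w(4) by (metis not_le)
    with xwy have "w \<in> W" by (simp add: W_def)
    with w show ?thesis by blast
  qed
  have ne: "W \<noteq> {}" using W dense[OF assms] by blast
  have "transp R" "irreflp R" using trans irrefl by (auto intro: transpI irreflpI)
  then obtain w where w: "w \<in> W" "\<forall>u\<in>W. \<not> R w u"
    using ex_maximal_element fin ne by metis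
  then have xw: "R x w" "R w y" by (auto simp: W_def)
  obtain z where z: "R w z" "R z y" using dense xw by blast
  then obtain u where u: "u \<in> W" "\<not> R z u" "\<not> R u z" using W trans xw by blast
  then have "u \<in> D" using R_dom by (auto simp: W_def)
  then have "R w u" using negtrans z u by blast
  with w u show False by blast
qed

lemma R_empty: "\<not> R x y"
proof (cases "m = 0")
  case True
  then have "x = y" if "R x y" using R_dom[OF that] dom_len by auto
  with irrefl show ?thesis by blast
next
  case False
  then obtain C N where N: "N > 0" and per: "\<And>x y s k. length x = m \<Longrightarrow> length y = m \<Longrightarrow>
     s > C * (1 + sum_list x + sum_list y) \<Longrightarrow>
     norm_between x y ((s + N * k) # replicate (m - 1) 0) = norm_between x y (s # replicate (m - 1) 0)"
    using definable_eventually_periodic[OF norm_between_definable] by blast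
  show ?thesis
  proof (rule no_fast_growing_order)
    fix n x y assume xy: "R x y" "sum_list x \<le> n" "sum_list y \<le> n"
    then have len: "length x = m" "length y = m" using R_dom dom_len by blast+
    define B where "B = C * (1 + 2 * n)"
    have B: "C * (1 + sum_list x + sum_list y) \<le> B"
      unfolding B_def using xy by (intro mult_le_mono2) simp
    obtain z where z: "R x z" "R z y" "least_norm z" "B < sum_list z"
      using norm_between_unbounded[OF xy(1)] by blast
    \<comment> \<open>\<open>s\<close> is congruent to \<open>sum_list z\<close> modulo
      \<open>N\<close> and lies between \<open>B + 1\<close> and \<open>B + N\<close>. Periodicity
      carries the norm of \<open>z\<close> down to \<open>s\<close> and from there up to every
      \<open>s + N * i\<close>.\<close>
    define s where "s = B + 1 + (sum_list z - B - 1) mod N"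
    define k where "k = (sum_list z - B - 1) div N"
    have sk: "sum_list z = s + N * k"
      using z(4) mult_div_mod_eq[of N "sum_list z - B - 1"] unfolding s_def k_def by simp
    have s: "B < s" "s \<le> B + N" using mod_less_divisor[OF N, of "sum_list z - B - 1"]
      by (simp_all add: s_def Suc_leI)
    have "norm_between x y ((s + N * k) # replicate (m - 1) 0)"
      unfolding norm_between_def using z sk by (intro exI[of _ z]) simp
    then have "norm_between x y ((s + N * i) # replicate (m - 1) 0)" for i
      using per[OF len] s B by (meson le_less_trans)
    then have "\<forall>i. \<exists>z. R x z \<and> R z y \<and> least_norm z \<and> sum_list z = s + N * i"
      unfolding norm_between_def by (simp add: sum_list_replicate)
    then obtain f where f: "\<And>i. R x (f i) \<and> R (f i) y \<and> least_norm (f i) \<and> sum_list (f i) = s + N * i"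
      by metis
    \<comment> \<open>Incomparable elements of least norm have equal norms, whereas the norms of the
      \<open>f i\<close> are pairwise distinct.\<close>
    have inj: "i = j" if "\<not> R (f i) (f j)" "\<not> R (f j) (f i)" for i j
    proof -
      have "sum_list (f i) = sum_list (f j)"
        using f[of i] f[of j] that R_dom unfolding least_norm_def by (metis order_antisym)
      then show ?thesis using f N by simp
    qed
    then have "inj f" using irrefl by (metis injI)
    then have "card (f ` {..<n}) = n"
      by (simp add: card_image inj_on_subset)
    moreover have "chain_between R sum_list ((2 * C + N) * (n + 1)) x y (f ` {..<n})"
    proof -
      have "s + N * i \<le> (2 * C + N) * (n + 1)" if "i < n" for i
      proof -
        have "N * i \<le> N * n" using that by simp
        with s(2) have "s + N * i \<le> B + N + N * n" by linarith
        also have "\<dots> \<le> (2 * C + N) * (n + 1)" by (simp add: B_def algebra_simps)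
        finally show ?thesis .
      qed
      moreover have "comparable_set R (f ` {..<n})"
        unfolding comparable_set_def using inj by blast
      ultimately show ?thesis
        using f by (simp add: chain_between_def)
    qed
    ultimately show "\<exists>Z. chain_between R sum_list ((2 * C + N) * (n + 1)) x y Z \<and> card Z = n"
      by blast
  qed (use R_dom dom_len trans irrefl N in auto)
qed

end

section \<open>Models of Presburger arithmetic\<close>

lemma is_model_PrA_sat:
  assumes "is_model S PrA" "free_vars p = {}" "\<And>e. sat nat_add e p"
    and "x \<in> univ S"
    and "sat S (\<lambda>_. x) p \<longleftrightarrow> Q"
  shows Q
proof -
  have "p \<in> PrA"
    using assms(2,3) by (simp add: PrA_def theory_of_def sentence_def holds_def)
  then have "holds S p" using assms(1) by (simp add: is_model_def)
  then show ?thesis using assms(4,5) by (auto simp: holds_def)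
qed

text \<open>A cancellative commutative monoid, linearly ordered by its addition, discrete with least
  positive element \<open>one\<close>, in which every element is even or odd. \<open>zero\<close>
  and \<open>one\<close> are parameters because the signature has addition only.\<close>

locale presburger_model =
  fixes S :: "'a add_structure" and zero one :: 'a
  assumes closed: "\<And>x y. x \<in> univ S \<Longrightarrow> y \<in> univ S \<Longrightarrow> add S x y \<in> univ S"
    and assoc: "\<And>x y z. x \<in> univ S \<Longrightarrow> y \<in> univ S \<Longrightarrow> z \<in> univ S \<Longrightarrow>
      add S (add S x y) z = add S x (add S y z)"
    and comm: "\<And>x y. x \<in> univ S \<Longrightarrow> y \<in> univ S \<Longrightarrow> add S x y = add S y x"
    and cancel: "\<And>x y z. x \<in> univ S \<Longrightarrow> y \<in> univ S \<Longrightarrow> z \<in> univ S \<Longrightarrow>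
      add S x y = add S x z \<Longrightarrow> y = z"
    and diff: "\<And>x y. x \<in> univ S \<Longrightarrow> y \<in> univ S \<Longrightarrow>
      \<exists>z\<in>univ S. y = add S x z \<or> x = add S y z"
    and zero: "zero \<in> univ S" "\<And>x. x \<in> univ S \<Longrightarrow> add S x zero = x"
    and sum_zero: "\<And>x y. x \<in> univ S \<Longrightarrow> y \<in> univ S \<Longrightarrow> add S x y = zero \<Longrightarrow> x = zero"
    and one: "one \<in> univ S" "one \<noteq> zero"
    and pred: "\<And>x. x \<in> univ S \<Longrightarrow> x \<noteq> zero \<Longrightarrow> \<exists>y\<in>univ S. x = add S y one"
    and half: "\<And>x. x \<in> univ S \<Longrightarrow>
      \<exists>y\<in>univ S. x = add S y y \<or> x = add S (add S y y) one"

lemma is_model_PrA_presburger_model: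
  assumes "is_model S PrA"
  shows "\<exists>zero one. presburger_model S zero one"
proof -
  let ?All = "\<lambda>x p. Defs.Neg (Ex x (Defs.Neg p))"
  let ?Or = "\<lambda>p q. Defs.Neg (Conj (Defs.Neg p) (Defs.Neg q))"
  let ?Imp = "\<lambda>p q. Defs.Neg (Conj p (Defs.Neg q))"
  let ?eq = Defs.Eq and ?v = Var and ?p = Plus
  have str: "is_structure S" using assms by (simp add: is_model_def)
  then obtain a where a: "a \<in> univ S" by (auto simp: is_structure_def)
  note ax = is_model_PrA_sat[OF assms _ _ a]
  have assoc: "\<forall>x\<in>univ S. \<forall>y\<in>univ S. \<forall>z\<in>univ S. add S (add S x y) z = add S x (add S y z)"
    by (rule ax[of "?All 0 (?All 1 (?All 2 (?eq (?p (?p (?v 0) (?v 1)) (?v 2)) (?p (?v 0) (?p (?v 1) (?v 2))))))"], fastforce,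
        simp add: nat_add_def, simp)
  have comm: "\<forall>x\<in>univ S. \<forall>y\<in>univ S. add S x y = add S y x"
    by (rule ax[of "?All 0 (?All 1 (?eq (?p (?v 0) (?v 1)) (?p (?v 1) (?v 0))))"], fastforce,
        simp add: nat_add_def, simp)
  have cancel: "\<forall>x\<in>univ S. \<forall>y\<in>univ S. \<forall>z\<in>univ S. add S x y = add S x z \<longrightarrow> y = z"
    by (rule ax[of "?All 0 (?All 1 (?All 2 (?Imp (?eq (?p (?v 0) (?v 1)) (?p (?v 0) (?v 2))) (?eq (?v 1) (?v 2)))))"], fastforce,
        simp add: nat_add_def, simp)
  have ex_diff: "\<exists>z. y = x + z \<or> x = y + z" for x y :: nat
    by presburger
  have diff: "\<forall>x\<in>univ S. \<forall>y\<in>univ S. \<exists>z\<in>univ S. y = add S x z \<or> x = add S y z"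
    by (rule ax[of "?All 0 (?All 1 (Ex 2 (?Or (?eq (?v 1) (?p (?v 0) (?v 2))) (?eq (?v 0) (?p (?v 1) (?v 2))))))"], fastforce,
        simp add: nat_add_def ex_diff, simp)
  \<comment> \<open>No name for zero is available yet, so being zero is expressed as leaving
    \<open>z\<close> unchanged; putting \<open>zero\<close> for \<open>z\<close> yields the
    axiom.\<close>
  have sum_zero: "\<forall>x\<in>univ S. \<forall>y\<in>univ S. \<forall>z\<in>univ S. add S (add S x y) z = z \<longrightarrow> add S x z = z"
    by (rule ax[of "?All 0 (?All 1 (?All 2 (?Imp (?eq (?p (?p (?v 0) (?v 1)) (?v 2)) (?v 2)) (?eq (?p (?v 0) (?v 2)) (?v 2)))))"], fastforce,
        simp add: nat_add_def, simp)
  \<comment> \<open>A single sentence, so that all the properties concern the same two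
    elements.\<close>
  have "\<exists>zero\<in>univ S. \<exists>one\<in>univ S. (\<forall>x\<in>univ S. add S x zero = x) \<and> one \<noteq> zero \<and>
      (\<forall>x\<in>univ S. x = zero \<or> (\<exists>y\<in>univ S. x = add S y one)) \<and>
      (\<forall>x\<in>univ S. \<exists>y\<in>univ S. x = add S y y \<or> x = add S (add S y y) one)"
  proof -
    let ?f = "Ex 0 (Ex 1 (Conj (?All 2 (?eq (?p (?v 2) (?v 0)) (?v 2)))
        (Conj (Defs.Neg (?eq (?v 1) (?v 0)))
        (Conj (?All 2 (?Or (?eq (?v 2) (?v 0)) (Ex 3 (?eq (?v 2) (?p (?v 3) (?v 1))))))
          (?All 2 (Ex 3 (?Or (?eq (?v 2) (?p (?v 3) (?v 3)))
             (?eq (?v 2) (?p (?p (?v 3) (?v 3)) (?v 1))))))))))"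
    have "\<exists>y. x = y + y \<or> x = Suc (y + y)" for x :: nat by presburger
    moreover have "x = 0 \<or> (\<exists>y. x = Suc y)" for x :: nat by presburger
    ultimately have nat: "sat nat_add e ?f" for e
      by (simp add: nat_add_def) (rule exI[of _ "Suc 0"], simp)
    show ?thesis
      by (rule ax[of ?f], fastforce, rule nat, simp)
  qed
  then obtain zero one where "zero \<in> univ S" "one \<in> univ S" "\<forall>x\<in>univ S. add S x zero = x"
    "one \<noteq> zero" "\<forall>x\<in>univ S. x = zero \<or> (\<exists>y\<in>univ S. x = add S y one)"
    "\<forall>x\<in>univ S. \<exists>y\<in>univ S. x = add S y y \<or> x = add S (add S y y) one"
    by (elim bexE conjE)
  then have "presburger_model S zero one"
    using str assoc comm cancel diff sum_zero
    unfolding presburger_model_def is_structure_def by (intro conjI allI impI) metis+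
  then show ?thesis by blast
qed

section \<open>Order and intervals in a model\<close>

context presburger_model
begin

lemma left_commute:
  "x \<in> univ S \<Longrightarrow> y \<in> univ S \<Longrightarrow> z \<in> univ S \<Longrightarrow> add S x (add S y z) = add S y (add S x z)"
  by (metis assoc comm)

definition le :: "'a \<Rightarrow> 'a \<Rightarrow> bool" where
  "le x y \<longleftrightarrow> (\<exists>z\<in>univ S. y = add S x z)"

definition interval :: "'a \<Rightarrow> 'a \<Rightarrow> 'a set" where
  "interval x y = {z \<in> univ S. le x z \<and> le z y}"

definition far :: "'a \<Rightarrow> 'a \<Rightarrow> bool" where
  "far x y \<longleftrightarrow> x \<in> univ S \<and> y \<in> univ S \<and> le x y \<and> infinite (interval x y)"

lemma le_refl: "x \<in> univ S \<Longrightarrow> le x x"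
  unfolding le_def using zero by metis

lemma le_add: "x \<in> univ S \<Longrightarrow> y \<in> univ S \<Longrightarrow> le x (add S x y)"
  unfolding le_def by blast

lemma le_trans: "x \<in> univ S \<Longrightarrow> le x y \<Longrightarrow> le y z \<Longrightarrow> le x z"
  unfolding le_def using assoc closed by metis

lemma le_total: "x \<in> univ S \<Longrightarrow> y \<in> univ S \<Longrightarrow> le x y \<or> le y x"
  unfolding le_def using diff by metis

lemma le_antisym:
  assumes "x \<in> univ S" "le x y" "le y x"
  shows "x = y"
proof -
  obtain z w where zw: "z \<in> univ S" "y = add S x z" "w \<in> univ S" "x = add S y w"
    using assms(2,3) by (auto simp: le_def)
  then have "add S x (add S z w) = add S x zero"
    using assoc assms(1) zero(2) by metis
  then have "add S z w = zero" using cancel closed zw assms(1) zero(1) by metis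
  then have "z = zero" using sum_zero zw by metis
  then show ?thesis using zw zero(2) assms(1) by simp
qed

lemma le_add_cancel:
  assumes "x \<in> univ S" "y \<in> univ S" "z \<in> univ S"
  shows "le (add S x y) (add S x z) \<longleftrightarrow> le y z"
  unfolding le_def using assms assoc cancel closed by metis

lemma interval_split:
  "x \<in> univ S \<Longrightarrow> y \<in> univ S \<Longrightarrow> interval x z \<subseteq> interval x y \<union> interval y z"
  unfolding interval_def using le_total by blast

lemma interval_mono: "le x' x \<Longrightarrow> x' \<in> univ S \<Longrightarrow> le y y' \<Longrightarrow> interval x y \<subseteq> interval x' y'"
  unfolding interval_def using le_trans by blast

lemma interval_translate:
  assumes "x \<in> univ S" "y \<in> univ S" "c \<in> univ S"
  shows "interval (add S c x) (add S c y) = add S c ` interval x y"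
proof (intro equalityI subsetI)
  fix w assume "w \<in> interval (add S c x) (add S c y)"
  then have w: "w \<in> univ S" "le (add S c x) w" "le w (add S c y)" by (auto simp: interval_def)
  then obtain d where d: "d \<in> univ S" "w = add S (add S c x) d" by (auto simp: le_def)
  then have "w = add S c (add S x d)" using assoc assms by simp
  moreover have "add S x d \<in> interval x y"
    using w d assms le_add_cancel[of c "add S x d" y] closed calculation le_add
    by (auto simp: interval_def)
  ultimately show "w \<in> add S c ` interval x y" by blast
qed (use assms closed le_add_cancel in \<open>auto simp: interval_def\<close>)

lemma interval_translate_finite:
  assumes "x \<in> univ S" "y \<in> univ S" "c \<in> univ S"
  shows "finite (interval (add S c x) (add S c y)) \<longleftrightarrow> finite (interval x y)"
proof -
  have "inj_on (add S c) (interval x y)"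
    using cancel assms by (auto simp: inj_on_def interval_def)
  then show ?thesis by (simp add: interval_translate assms finite_image_iff)
qed

lemma far_irrefl: "\<not> far x x"
proof -
  have "interval x x \<subseteq> {x}" if "x \<in> univ S" using le_antisym that by (auto simp: interval_def)
  then show ?thesis unfolding far_def using finite_subset by blast
qed

lemma far_trans: "far x y \<Longrightarrow> far y z \<Longrightarrow> far x z"
  unfolding far_def using le_trans interval_mono[of x x y z] le_refl finite_subset by metis

text \<open>Cutting an infinite interval at \<open>y\<close> leaves an infinite piece. If
  \<open>y\<close> lies outside, one of the two new intervals contains the old one.\<close>

lemma far_negtrans:
  assumes "far x z" "y \<in> univ S"
  shows "far x y \<or> far y z"
proof -
  have xz: "x \<in> univ S" "z \<in> univ S" "le x z" "infinite (interval x z)"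
    using assms by (auto simp: far_def)
  have *: "infinite (interval x y) \<or> infinite (interval y z)"
    using finite_subset[OF interval_split[OF xz(1) assms(2), of z]] xz(4) by auto
  consider "le y x" | "le x y" "le y z" | "le z y"
    using le_total xz assms by blast
  then show ?thesis
  proof cases
    case 1
    have "infinite (interval y z)"
      using finite_subset[OF interval_mono[OF 1 assms(2) le_refl[OF xz(2)]]] xz(4) by metis
    then show ?thesis using le_trans[OF assms(2) 1 xz(3)] xz(2) assms(2) by (simp add: far_def)
  next
    case 2
    then show ?thesis using * xz assms by (auto simp: far_def)
  next
    case 3
    have "infinite (interval x y)"
      using finite_subset[OF interval_mono[OF le_refl[OF xz(1)] xz(1) 3]] xz(4) by metis
    then show ?thesis using le_trans[OF xz(1,3) 3] xz(1) assms(2) by (simp add: far_def)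
  qed
qed

text \<open>Take the midpoint: with \<open>c\<close> half of the distance, rounded down,
  \<open>z = x + c\<close> and \<open>w = z + c\<close>, the element \<open>y\<close> is
  \<open>w\<close> or its successor. The intervals from \<open>x\<close> to \<open>z\<close> and
  from \<open>z\<close> to \<open>w\<close> are translates of each other and the one from
  \<open>w\<close> to \<open>y\<close> is finite, so the first two must be infinite.\<close>

lemma far_dense:
  assumes "far x y"
  shows "\<exists>z. far x z \<and> far z y"
proof -
  have xy: "x \<in> univ S" "y \<in> univ S" "le x y" "infinite (interval x y)"
    using assms by (auto simp: far_def)
  then obtain d where d: "d \<in> univ S" "y = add S x d" by (auto simp: le_def)
  obtain c where c: "c \<in> univ S" "d = add S c c \<or> d = add S (add S c c) one"
    using half d by blast
  define z w where "z = add S x c" and "w = add S z c"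
  have zw: "z \<in> univ S" "w \<in> univ S" "le x z" "le z w"
    using closed xy c le_add by (simp_all add: z_def w_def)
  have w: "w = add S x (add S c c)" using assoc xy c by (simp add: w_def z_def)
  have eq: "finite (interval z w) \<longleftrightarrow> finite (interval x z)"
  proof -
    have "z = add S c x" "w = add S c z"
      using comm xy(1) c(1) zw(1) by (simp_all add: z_def w_def)
    then show ?thesis using interval_translate_finite[OF xy(1) zw(1) c(1)] by metis
  qed
  have wy: "le w y \<and> finite (interval w y)"
    using c(2)
  proof
    assume "d = add S c c"
    then have "y = w" using d w by simp
    moreover have "interval w w \<subseteq> {w}" using le_antisym zw by (auto simp: interval_def)
    ultimately show ?thesis using le_refl zw finite_subset by auto
  next
    assume "d = add S (add S c c) one"
    then have y: "y = add S w one" using d w assoc closed xy c one by simp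
    have "interval w y \<subseteq> {w, y}"
    proof
      fix u assume "u \<in> interval w y"
      then obtain p where u: "p \<in> univ S" "u = add S w p" "le u y" by (auto simp: interval_def le_def)
      then have "le p one" using y le_add_cancel zw one by metis
      then obtain q where q: "q \<in> univ S" "one = add S p q" by (auto simp: le_def)
      \<comment> \<open>Nothing lies strictly between \<open>zero\<close> and \<open>one\<close>:
        \<open>p = r + one\<close> and \<open>one = p + q\<close> force
        \<open>r = zero\<close>.\<close>
      show "u \<in> {w, y}"
      proof (cases "p = zero")
        case True
        then show ?thesis using u zero(2) zw by simp
      next
        case False
        then obtain r where r: "r \<in> univ S" "p = add S r one" using pred u by blast
        have "add S one (add S r q) = add S one zero"
          using q r assoc comm left_commute one zero closed by metis
        then have "add S r q = zero" using cancel one zero closed r q by metis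
        then have "r = zero" using sum_zero r q by blast
        then have "p = one" using r comm zero one by metis
        then show ?thesis using u y by simp
      qed
    qed
    then have "finite (interval w y)" by (rule finite_subset) simp
    then show ?thesis using y le_add zw one by simp
  qed
  have "infinite (interval x z)"
  proof
    assume "finite (interval x z)"
    then have "finite (interval x z)" "finite (interval z w)" "finite (interval w y)"
      using eq wy by simp_all
    then have "finite (interval z y)" using finite_subset[OF interval_split[OF zw(1,2), of y]] by simp
    with \<open>finite (interval x z)\<close> have "finite (interval x y)"
      using finite_subset[OF interval_split[OF xy(1) zw(1), of y]] by simp
    with xy(4) show False by simp
  qed
  moreover have "infinite (interval z y)"
    using calculation eq finite_subset[OF interval_mono[OF le_refl[OF zw(1)] zw(1) conjunct1[OF wy]]]
    by metis
  moreover have "le z y" using le_trans[OF zw(1,4) conjunct1[OF wy]] .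
  ultimately show ?thesis using xy zw by (auto simp: far_def)
qed

text \<open>Without infinite intervals every element is a finite multiple of \<open>one\<close>.\<close>

lemma not_far_isomorphic:
  assumes "\<And>x y. \<not> far x y"
  shows "isomorphic S nat_add"
proof -
  define g where "g n = ((\<lambda>x. add S x one) ^^ n) zero" for n
  have g0: "g 0 = zero" and gS: "g (Suc n) = add S (g n) one" for n
    by (simp_all add: g_def)
  have gU: "g n \<in> univ S" for n by (induction n) (simp_all add: g0 gS zero one closed)
  have g_add: "g (k + n) = add S (g k) (g n)" for k n
    by (induction n) (simp_all add: g0 gS zero gU assoc one)
  have inj: "inj g"
  proof -
    have "g n \<noteq> g (n + Suc k)" for n k
    proof
      assume "g n = g (n + Suc k)"
      then have "add S (g n) zero = add S (g n) (g (Suc k))" by (metis g_add gU zero(2))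
      then have "zero = add S (g k) one" using cancel gU zero(1) gS by metis
      then have "one = zero" using sum_zero comm gU one(1) by metis
      with one(2) show False by simp
    qed
    then have "g i \<noteq> g j" if "i < j" for i j
      using that by (metis less_iff_Suc_add add_Suc_right)
    then show ?thesis by (metis injI linorder_neqE_nat)
  qed
  have "x \<in> range g" if x: "x \<in> univ S" for x
  proof (rule ccontr)
    assume nr: "x \<notin> range g"
    \<comment> \<open>As \<open>x\<close> is no multiple of \<open>one\<close>, its distance from
      each multiple is nonzero and allows one more step. So \<open>x\<close> lies above all
      multiples, and the interval from \<open>zero\<close> to \<open>x\<close> is infinite.\<close>
    have "le (g n) x" for n
    proof (induction n)
      case 0
      show ?case unfolding le_def g0 using x comm zero by metis
    next
      case (Suc n)
      then obtain d where d: "d \<in> univ S" "x = add S (g n) d" by (auto simp: le_def)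
      have "d \<noteq> zero" using d nr gU zero(2) by (metis rangeI)
      then obtain r where r: "r \<in> univ S" "d = add S r one" using pred d by blast
      then have "x = add S (g (Suc n)) r" using d gS gU assoc comm one(1) by metis
      then show ?case using r by (auto simp: le_def)
    qed
    moreover have "le zero (g n)" for n unfolding le_def using gU comm zero by metis
    ultimately have "range g \<subseteq> interval zero x" "le zero x"
      using gU g0 by (auto simp: interval_def)
    moreover have "infinite (range g)" using inj finite_imageD infinite_UNIV_nat by blast
    ultimately have "far zero x" unfolding far_def using zero x finite_subset by blast
    with assms show False by blast
  qed
  then have bij: "bij_betw g UNIV (univ S)" using inj gU by (auto simp: bij_betw_def)
  then have "bij_betw (inv g) (univ S) UNIV" by (rule bij_betw_inv_into)
  moreover have "inv g (add S x y) = inv g x + inv g y" if xy: "x \<in> univ S" "y \<in> univ S" for x y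
  proof -
    have "x \<in> range g" "y \<in> range g" using xy bij by (simp_all add: bij_betw_def)
    then obtain i j where "x = g i" "y = g j" by blast
    then show ?thesis using inj g_add by (metis inv_f_f)
  qed
  ultimately show ?thesis unfolding isomorphic_def nat_add_def by auto
qed

end

section \<open>Interpreted models\<close>

text \<open>\<open>v\<close> names the elements by tuples in \<open>D\<close>, possibly with many
  names for one element. Pulled back along \<open>v\<close>, \<open>far\<close> is a definable dense
  order on tuples, hence empty by \<open>R_empty\<close>.\<close>

lemma (in presburger_model) definable_not_far:
  fixes v :: "nat list \<Rightarrow> 'a"
  assumes dom_len: "\<And>b. b \<in> D \<Longrightarrow> length b = m"
    and surj: "v ` D = univ S"
    and dom_def: "definable m (\<lambda>\<tau>. \<tau> 0 \<in> D)"
    and eq_def: "definable m (\<lambda>\<tau>. \<tau> 0 \<in> D \<and> \<tau> 1 \<in> D \<and> v (\<tau> 0) = v (\<tau> 1))"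
    and add_def: "definable m (\<lambda>\<tau>. \<tau> 0 \<in> D \<and> \<tau> 1 \<in> D \<and> \<tau> 2 \<in> D \<and>
      v (\<tau> 0) = add S (v (\<tau> 1)) (v (\<tau> 2)))"
  shows "\<not> far x y"
proof -
  have vU: "v b \<in> univ S" if "b \<in> D" for b using surj that by blast
  define leD where "leD a b \<longleftrightarrow> a \<in> D \<and> b \<in> D \<and> le (v a) (v b)" for a b
  define eqD where "eqD a b \<longleftrightarrow> a \<in> D \<and> b \<in> D \<and> v a = v b" for a b
  define farD where "farD a b \<longleftrightarrow> a \<in> D \<and> b \<in> D \<and> far (v a) (v b)" for a b
  \<comment> \<open>This makes finiteness first-order: the norm of \<open>t\<close> is the numerical
    bound, and one short name \<open>w\<close> per element suffices, since an element may also have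
    arbitrarily long names.\<close>
  define bounded where "bounded a b \<longleftrightarrow> (\<exists>t. length t = m \<and> (\<forall>z. length z = m \<longrightarrow> leD a z \<and> leD z b \<longrightarrow>
     (\<exists>w. length w = m \<and> eqD z w \<and> sum_list w \<le> sum_list t)))" for a b
  have bounded_iff: "bounded a b \<longleftrightarrow> finite (interval (v a) (v b))" if ab: "a \<in> D" "b \<in> D" for a b
  proof
    assume "bounded a b"
    then obtain t where t: "\<And>z. length z = m \<Longrightarrow> leD a z \<and> leD z b \<Longrightarrow>
       \<exists>w. length w = m \<and> eqD z w \<and> sum_list w \<le> sum_list t"
      unfolding bounded_def by blast
    have "interval (v a) (v b) \<subseteq> v ` {w. length w = m \<and> sum_list w \<le> sum_list t}"
    proof
      fix x assume x: "x \<in> interval (v a) (v b)"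
      then have "x \<in> v ` D" unfolding surj by (simp add: interval_def)
      then obtain z where z: "z \<in> D" "x = v z" by blast
      with x ab have "leD a z \<and> leD z b" by (simp add: leD_def interval_def)
      from t[OF dom_len[OF z(1)] this]
      obtain w where "length w = m" "eqD z w" "sum_list w \<le> sum_list t" by (elim exE conjE)
      then show "x \<in> v ` {w. length w = m \<and> sum_list w \<le> sum_list t}"
        using z(2) by (auto simp: eqD_def)
    qed
    then show "finite (interval (v a) (v b))"
      by (rule finite_subset) (intro finite_imageI finite_bounded_sum_list)
  next
    assume fin: "finite (interval (v a) (v b))"
    have "\<forall>x\<in>univ S. \<exists>w. w \<in> D \<and> v w = x"
      unfolding surj[symmetric] by blast
    then obtain r where r: "\<forall>x\<in>univ S. r x \<in> D \<and> v (r x) = x"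
      by (rule bchoice[THEN exE])
    \<comment> \<open>The zero tuple keeps \<open>W\<close> nonempty when the interval is empty, so
      that a maximal norm exists.\<close>
    define W where "W = insert (replicate m 0) (r ` interval (v a) (v b))"
    have W: "finite W" "W \<noteq> {}" using fin by (simp_all add: W_def)
    have Wlen: "length w = m" if "w \<in> W" for w
      using that r dom_len by (auto simp: W_def interval_def)
    have "Max (sum_list ` W) \<in> sum_list ` W"
      by (rule Max_in) (simp_all add: W)
    then obtain t where t: "Max (sum_list ` W) = sum_list t" "t \<in> W" by (rule imageE)
    have le_t: "sum_list w \<le> sum_list t" if "w \<in> W" for w
      using W(1) that by (simp flip: t(1))
    have "\<exists>w. length w = m \<and> eqD z w \<and> sum_list w \<le> sum_list t" if "leD a z \<and> leD z b" for z
    proof (intro exI conjI)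
      have z: "z \<in> D" "v z \<in> interval (v a) (v b)" using that vU by (auto simp: leD_def interval_def)
      then have W: "r (v z) \<in> W" by (simp add: W_def)
      then show "length (r (v z)) = m" "sum_list (r (v z)) \<le> sum_list t"
        by (simp_all add: Wlen le_t)
      show "eqD z (r (v z))" using r vU[OF z(1)] z(1) by (simp add: eqD_def)
    qed
    then show "bounded a b" unfolding bounded_def using Wlen[OF t(2)] by blast
  qed
  have "definable m (\<lambda>\<tau>. \<exists>c. length c = m \<and> (\<tau> 1 \<in> D \<and> \<tau> 0 \<in> D \<and> c \<in> D \<and>
      v (\<tau> 1) = add S (v (\<tau> 0)) (v c)))"
    using definable_ex[OF definable_subst3[where P = "\<lambda>a b c. a \<in> D \<and> b \<in> D \<and> c \<in> D \<and>
      v a = add S (v b) (v c)", OF add_def, of 1 0 2], of 2] by simp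
  moreover have "leD a b \<longleftrightarrow> (\<exists>c. length c = m \<and> (b \<in> D \<and> a \<in> D \<and> c \<in> D \<and>
      v b = add S (v a) (v c)))" for a b
  proof -
    have "le (v a) (v b) \<longleftrightarrow> (\<exists>c\<in>D. v b = add S (v a) (v c))"
      unfolding le_def surj[symmetric] by blast
    then show ?thesis using dom_len by (auto simp: leD_def)
  qed
  ultimately have "definable m (\<lambda>\<tau>. leD (\<tau> 0) (\<tau> 1))" by (simp only:)
  note le = definable_subst2[where P = leD, OF this]
  note eq = definable_subst2[where P = eqD, OF eq_def[folded eqD_def]]
  note norm = definable_subst2[where m = m and P = "\<lambda>a b. sum_list a \<le> sum_list b", OF definable_norm_le]
  \<comment> \<open>Blocks 0 and 1 hold the endpoints; blocks 2, 3 and 4 hold the quantified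
    \<open>t\<close>, \<open>z\<close> and \<open>w\<close>.\<close>
  have "definable m (\<lambda>\<tau>. bounded (\<tau> 0) (\<tau> 1))"
    unfolding bounded_def
    using definable_ex[OF definable_all[OF definable_imp[OF definable_conj[OF le[of 0 3] le[of 3 1]]
       definable_ex[OF definable_conj[OF eq[of 3 4] norm[of 4 2]], of 4]], of 3], of 2]
    by simp
  then have "definable m (\<lambda>\<tau>. leD (\<tau> 0) (\<tau> 1) \<and> \<not> bounded (\<tau> 0) (\<tau> 1))"
    by (rule definable_conj[OF le definable_neg])
  moreover have "farD a b \<longleftrightarrow> leD a b \<and> \<not> bounded a b" for a b
    using bounded_iff[of a b] vU by (auto simp: farD_def leD_def far_def)
  ultimately have farD_def': "definable m (\<lambda>\<tau>. farD (\<tau> 0) (\<tau> 1))" by (simp only:)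
  interpret definable_dense_order m D farD
  proof
    show "farD a c \<or> farD c b" if "farD a b" "c \<in> D" for a b c
      using that far_negtrans[of "v a" "v b" "v c"] vU by (auto simp: farD_def)
    show "\<exists>c. farD a c \<and> farD c b" if ab: "farD a b" for a b
    proof -
      obtain z where z: "far (v a) z" "far z (v b)" using far_dense ab by (auto simp: farD_def)
      then have "z \<in> v ` D" unfolding surj by (simp add: far_def)
      then show ?thesis using z ab by (auto simp: farD_def)
    qed
    show "farD a c" if "farD a b" "farD b c" for a b c
      using that far_trans by (auto simp: farD_def)
  qed (use dom_len dom_def farD_def' far_irrefl in \<open>auto simp: farD_def\<close>)
  show ?thesis
  proof
    assume xy: "far x y"
    then have "x \<in> v ` D" "y \<in> v ` D" unfolding surj by (simp_all add: far_def)
    then obtain a b where "a \<in> D" "x = v a" "b \<in> D" "y = v b" by blast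
    with xy have "farD a b" by (simp add: farD_def)
    with R_empty show False by blast
  qed
qed

theorem theorem2:
  fixes m :: nat and \<AA> :: "'a add_structure"
  assumes "is_model \<AA> PrA"
    and "interpreted_in m \<AA> nat_add"
  shows "isomorphic \<AA> nat_add"
proof -
  obtain zero one where "presburger_model \<AA> zero one"
    using is_model_PrA_presburger_model[OF assms(1)] by blast
  then interpret presburger_model \<AA> zero one .
  obtain \<iota> where \<iota>: "is_interpretation m \<iota> \<AA> nat_add"
    using assms(2) by (auto simp: interpreted_in_def)
  define D where "D = int_dom m \<iota> nat_add"
  define r where "r = int_rel m \<iota> nat_add"
  from \<iota> obtain h where fv: "is_translation m \<iota>" and equiv: "equiv D r"
    and h: "bij_betw h (D // r) (univ \<AA>)"
    and h_add: "\<forall>b0\<in>D. \<forall>b1\<in>D. \<forall>b2\<in>D. h (r `` {b0}) = add \<AA> (h (r `` {b1})) (h (r `` {b2}))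
      \<longleftrightarrow> sat_at nat_add (Fun_add \<iota>) (b0 @ b1 @ b2)"
    unfolding is_interpretation_def D_def[symmetric] r_def[symmetric] by (elim conjE exE)
  \<comment> \<open>\<open>v\<close> sends a tuple to the element it represents; the three formulas
    of the translation then supply the three definability hypotheses on \<open>D\<close> and
    \<open>v\<close>.\<close>
  define v where "v b = h (r `` {b})" for b
  have v_eq: "v b = v b' \<longleftrightarrow> sat_at nat_add (Pred_eq \<iota>) (b @ b')" if "b \<in> D" "b' \<in> D" for b b'
  proof -
    have "v b = v b' \<longleftrightarrow> r `` {b} = r `` {b'}"
      unfolding v_def using that
      by (intro inj_on_eq_iff[OF bij_betw_imp_inj_on[OF h]] quotientI)
    also have "\<dots> \<longleftrightarrow> (b, b') \<in> r" using eq_equiv_class_iff[OF equiv that] .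
    also have "\<dots> \<longleftrightarrow> sat_at nat_add (Pred_eq \<iota>) (b @ b')"
      using that by (simp add: r_def int_rel_def D_def)
    finally show ?thesis .
  qed
  have "v ` D = h ` (D // r)" by (auto simp: v_def quotient_def)
  then have surj: "v ` D = univ \<AA>" using h by (simp add: bij_betw_def)
  have len: "length b = m" if "b \<in> D" for b using that by (simp add: D_def int_dom_def)
  have "definable m (\<lambda>\<tau>. sat_at nat_add (Dom \<iota>) (\<tau> 0))"
    using definable_sat_at[of "Dom \<iota>" 1 m] fv by (simp add: is_translation_def)
  then have dom: "definable m (\<lambda>\<tau>. \<tau> 0 \<in> D)"
    by (rule definable_cong) (simp add: D_def int_dom_def nat_add_def)
  note D = definable_subst1[where P = "\<lambda>a. a \<in> D", OF dom]
  have "definable m (\<lambda>\<tau>. sat_at nat_add (Pred_eq \<iota>) (\<tau> 0 @ \<tau> 1))"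
    using definable_sat_at[of "Pred_eq \<iota>" 2 m] fv by (simp add: is_translation_def numeral_2_eq_2)
  from definable_conj[OF D definable_conj[OF D this]]
  have eq: "definable m (\<lambda>\<tau>. \<tau> 0 \<in> D \<and> \<tau> 1 \<in> D \<and> v (\<tau> 0) = v (\<tau> 1))"
    by (rule definable_cong) (auto simp: v_eq)
  have "definable m (\<lambda>\<tau>. sat_at nat_add (Fun_add \<iota>) (\<tau> 0 @ \<tau> 1 @ \<tau> 2))"
    using definable_sat_at[of "Fun_add \<iota>" 3 m] fv by (simp add: is_translation_def numeral_3_eq_3 numeral_2_eq_2)
  from definable_conj[OF D definable_conj[OF D definable_conj[OF D this]]]
  have "definable m (\<lambda>\<tau>. \<tau> 0 \<in> D \<and> \<tau> 1 \<in> D \<and> \<tau> 2 \<in> D \<and>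
      v (\<tau> 0) = add \<AA> (v (\<tau> 1)) (v (\<tau> 2)))"
    by (rule definable_cong) (use h_add in \<open>auto simp: v_def\<close>)
  from definable_not_far[OF len surj dom eq this] show ?thesis
    by (rule not_far_isomorphic)
qed

end
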